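(* For every integer $r\geq 1$ there exist $d\geq 3$, a vector $\alpha\in\mathbb{T}^d$ such that the rotation $T:\mathbb{T}^d\to\mathbb{T}^d$, $Tx=x+\alpha$, is minimal, and a function $\varphi:\mathbb{T}^d\to\mathbb{R}$ of class $C^r$ with zero mean ($\int_{\mathbb{T}^d}\varphi\,dx=0$) such that the cylindrical transformation $T_\varphi(x,t)=(x+\alpha,t+\varphi(x))$ on $\mathbb{T}^d\times\mathbb{R}$ is Besicovitch and $\dim_H D^{++}(\alpha,\varphi)>0$.
   Context: $\mathbb{T}=\mathbb{R}/\mathbb{Z}$; $\dim_H$ is Hausdorff dimension. For $n\in\mathbb{Z}$: $\varphi^{(n)}(x)=\sum_{k=0}^{n-1}\varphi(T^kx)$ for $n>0$, $\varphi^{(0)}=0$, $\varphi^{(n)}(x)=-\sum_{k=1}^{|n|}\varphi(T^{-k}x)$ for $n<0$. The orbit of $(x,t)$ under $T_\varphi$ is called discrete if $|\varphi^{(n)}(x)|\to+\infty$ as $|n|\to+\infty$. $T_\varphi$ is called Besicovitch if it has both a dense (two-sided) orbit and a discrete orbit. $D^{++}(\alpha,\varphi)=\{x\in\mathbb{T}^d:\varphi^{(m)}(x)\to+\infty\text{ as }|m|\to+\infty\}$. *)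

theory Defs
  imports "HOL-Probability.Probability"
begin

quotient_type circle = real / "\<lambda>x y. x - y \<in> \<int>"
  morphisms rep_circle to_circle
proof (rule equivpI)
  show "reflp (\<lambda>x y::real. x - y \<in> \<int>)"
    by (simp add: reflp_def)
  show "symp (\<lambda>x y::real. x - y \<in> \<int>)"
    by (auto simp: symp_def intro: Ints_minus[of "_ - _", simplified])
  show "transp (\<lambda>x y::real. x - y \<in> \<int>)"
  proof (rule transpI)
    fix x y z :: real assume "x - y \<in> \<int>" "y - z \<in> \<int>"
    from Ints_add[OF this] show "x - z \<in> \<int>" by simp
  qed
qed

lemma to_circle_eq_iff: "to_circle x = to_circle y \<longleftrightarrow> x - y \<in> \<int>"
  by (simp add: circle.abs_eq_iff)

instantiation circle :: ab_group_add
begin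

lift_definition zero_circle :: circle is 0 .

lift_definition plus_circle :: "circle \<Rightarrow> circle \<Rightarrow> circle" is "(+)"
  by (metis Ints_add add_diff_add)

lift_definition uminus_circle :: "circle \<Rightarrow> circle" is uminus
  by (metis Ints_minus minus_diff_minus)

lift_definition minus_circle :: "circle \<Rightarrow> circle \<Rightarrow> circle" is "(-)"
  by (metis (no_types, lifting) Ints_diff diff_diff_eq2 add_diff_eq diff_add_eq diff_diff_eq add.commute)

instance
  by standard (transfer; simp add: algebra_simps)+

end

lemma infdist_Ints_shift:
  fixes z k :: real
  assumes "k \<in> \<int>"
  shows "infdist (z + k) \<int> = infdist z \<int>"
proof -
  have le: "infdist (w + l) \<int> \<le> infdist w \<int>" if "l \<in> \<int>" for w l :: real
  proof -
    have "infdist (w + l) \<int> \<le> dist w n" if "n \<in> \<int>" for n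
      using infdist_le[of "n + l" "\<int>" "w + l"] that \<open>l \<in> \<int>\<close> by (simp add: dist_real_def)
    moreover have "(\<int> :: real set) \<noteq> {}" using Ints_0 by blast
    ultimately show ?thesis
      by (auto simp: infdist_notempty intro!: cINF_greatest)
  qed
  from le[OF assms, of z] le[of "- k" "z + k"] assms show ?thesis by simp
qed

lemma infdist_Ints_minus: "infdist (- z) \<int> = infdist (z::real) \<int>"
proof -
  have ne: "(\<int> :: real set) \<noteq> {}" using Ints_0 by blast
  have le: "infdist (- w) \<int> \<le> infdist w \<int>" for w :: real
  proof -
    have "infdist (- w) \<int> \<le> dist w n" if "n \<in> \<int>" for n
      using infdist_le[of "- n" "\<int>" "- w"] that by (simp add: dist_real_def)
    then show ?thesis
      using ne by (auto simp: infdist_notempty intro!: cINF_greatest)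
  qed
  from le[of z] le[of "- z"] show ?thesis by simp
qed

lemma closed_Ints_real: "closed (\<int> :: real set)"
  unfolding Ints_def by (rule closed_of_int_image)

instantiation circle :: metric_space
begin

lift_definition dist_circle :: "circle \<Rightarrow> circle \<Rightarrow> real" is "\<lambda>x y. infdist (x - y) \<int>"
proof -
  fix x x' y y' :: real
  assume "x - x' \<in> \<int>" "y - y' \<in> \<int>"
  then have "(x - x') - (y - y') \<in> \<int>" by (rule Ints_diff)
  from infdist_Ints_shift[OF this, of "x' - y'"]
  show "infdist (x - y) \<int> = infdist (x' - y') \<int>" by simp
qed

definition uniformity_circle :: "(circle \<times> circle) filter"
  where "uniformity_circle = (INF e\<in>{0<..}. principal {(x, y). dist x y < e})"

definition open_circle :: "circle set \<Rightarrow> bool"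
  where "open_circle U \<longleftrightarrow> (\<forall>x\<in>U. \<forall>\<^sub>F (x', y) in uniformity. x' = x \<longrightarrow> y \<in> U)"

instance
proof
  fix x y z :: circle
  show "dist x y = 0 \<longleftrightarrow> x = y"
  proof transfer
    fix x y :: real
    show "infdist (x - y) \<int> = 0 \<longleftrightarrow> x - y \<in> \<int>"
      using in_closed_iff_infdist_zero[OF closed_Ints_real, of "x - y"] Ints_0 by blast
  qed
  show "dist x y \<le> dist x z + dist y z"
  proof transfer
    fix x y z :: real
    have *: "infdist (x - y) \<int> \<le> infdist (x - z) \<int> + infdist (z - y) \<int>"
    proof -
      have ne: "(\<int> :: real set) \<noteq> {}" using Ints_0 by blast
      have "infdist (x - y) \<int> - infdist (z - y) \<int> \<le> dist (x - z) n" if "n \<in> \<int>" for n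
        using infdist_triangle[of "x - y" "\<int>" "z - y + n"]
          infdist_Ints_shift[OF that, of "z - y"]
        by (simp add: dist_real_def algebra_simps)
      then have "infdist (x - y) \<int> - infdist (z - y) \<int> \<le> infdist (x - z) \<int>"
        using ne by (auto simp: infdist_notempty intro!: cINF_greatest)
      then show ?thesis by simp
    qed
    show "infdist (x - y) \<int> \<le> infdist (x - z) \<int> + infdist (y - z) \<int>"
      using * infdist_Ints_minus[of "y - z"] by simp
  qed
qed (simp_all add: uniformity_circle_def open_circle_def)

end

lemma dist_to_circle: "dist (to_circle x) (to_circle y) = infdist (x - y) \<int>"
  by (simp add: dist_circle.abs_eq)

lemma dist_to_circle_le: "dist (to_circle x) (to_circle y) \<le> dist x y"
  using infdist_le[of 0 "\<int>" "x - y"] by (simp add: dist_to_circle dist_real_def)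

lemma continuous_on_to_circle: "continuous_on A to_circle"
proof (unfold continuous_on_iff, intro ballI allI impI)
  fix x :: real and e :: real assume "e > 0"
  then show "\<exists>d>0. \<forall>x'\<in>A. dist x' x < d \<longrightarrow> dist (to_circle x') (to_circle x) < e"
    using dist_to_circle_le le_less_trans by blast
qed

definition circle_measure :: "circle measure"
  where "circle_measure = distr (restrict_space lborel {0..<1}) borel to_circle"

lemma prob_space_circle_measure: "prob_space circle_measure"
proof -
  have "to_circle \<in> borel_measurable borel"
    using continuous_on_to_circle by (rule borel_measurable_continuous_onI)
  then have m: "to_circle \<in> measurable (restrict_space lborel {0..<1}) borel"
    by (simp add: measurable_restrict_space1)
  interpret prob_space "restrict_space lborel {0..<1::real}"
    by (rule prob_spaceI) (simp add: space_restrict_space emeasure_restrict_space)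
  from prob_space_distr[OF m] show ?thesis
    by (simp add: circle_measure_def)
qed

text \<open>
  The dimension is a natural number that is existentially quantified in the theorem, so points of
  \<open>\<real>\<^sup>d\<close> and of the torus are extensional functions on the index set \<open>{..<d}\<close>.
\<close>

definition torus :: "nat \<Rightarrow> (nat \<Rightarrow> circle) set"
  where "torus d = ({..<d} \<rightarrow>\<^sub>E UNIV)"

definition torus_metric :: "nat \<Rightarrow> (nat \<Rightarrow> circle) metric"
  where "torus_metric d = metric (torus d, \<lambda>x y. L2_set (\<lambda>i. dist (x i) (y i)) {..<d})"

lemma Metric_space_torus:
  "Metric_space (torus d) (\<lambda>x y. L2_set (\<lambda>i. dist (x i) (y i)) {..<d})"
proof
  fix x y z :: "nat \<Rightarrow> circle"
  show "0 \<le> L2_set (\<lambda>i. dist (x i) (y i)) {..<d}"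
    by simp
  show "L2_set (\<lambda>i. dist (x i) (y i)) {..<d} = L2_set (\<lambda>i. dist (y i) (x i)) {..<d}"
    by (simp add: dist_commute)
  show "L2_set (\<lambda>i. dist (x i) (y i)) {..<d} = 0 \<longleftrightarrow> x = y" if "x \<in> torus d" "y \<in> torus d"
    using that by (auto simp: L2_set_eq_0_iff torus_def intro: PiE_ext)
  have "L2_set (\<lambda>i. dist (x i) (z i)) {..<d} \<le> L2_set (\<lambda>i. dist (x i) (y i) + dist (y i) (z i)) {..<d}"
    by (rule L2_set_mono) (simp_all add: dist_triangle)
  also have "\<dots> \<le> L2_set (\<lambda>i. dist (x i) (y i)) {..<d} + L2_set (\<lambda>i. dist (y i) (z i)) {..<d}"
    by (rule L2_set_triangle_ineq)
  finally show "L2_set (\<lambda>i. dist (x i) (z i)) {..<d}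
      \<le> L2_set (\<lambda>i. dist (x i) (y i)) {..<d} + L2_set (\<lambda>i. dist (y i) (z i)) {..<d}" .
qed

lemma mspace_torus_metric [simp]: "mspace (torus_metric d) = torus d"
  by (simp add: torus_metric_def Metric_space.mspace_metric[OF Metric_space_torus])

lemma mdist_torus_metric:
  "mdist (torus_metric d) = (\<lambda>x y. L2_set (\<lambda>i. dist (x i) (y i)) {..<d})"
  by (simp add: torus_metric_def Metric_space.mdist_metric[OF Metric_space_torus])

abbreviation torus_topology :: "nat \<Rightarrow> (nat \<Rightarrow> circle) topology"
  where "torus_topology d \<equiv> mtopology_of (torus_metric d)"

definition torus_measure :: "nat \<Rightarrow> (nat \<Rightarrow> circle) measure"
  where "torus_measure d = (\<Pi>\<^sub>M i\<in>{..<d}. circle_measure)"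

definition torus_rotation :: "nat \<Rightarrow> (nat \<Rightarrow> circle) \<Rightarrow> (nat \<Rightarrow> circle) \<Rightarrow> (nat \<Rightarrow> circle)"
  where "torus_rotation d \<alpha> x = (\<lambda>i\<in>{..<d}. x i + \<alpha> i)"

definition to_torus :: "nat \<Rightarrow> (nat \<Rightarrow> real) \<Rightarrow> (nat \<Rightarrow> circle)"
  where "to_torus d x = (\<lambda>i\<in>{..<d}. to_circle (x i))"

definition partial_deriv :: "nat \<Rightarrow> ((nat \<Rightarrow> real) \<Rightarrow> real) \<Rightarrow> (nat \<Rightarrow> real) \<Rightarrow> real"
  where "partial_deriv i f x = deriv (\<lambda>t. f (x(i := t))) (x i)"

fun C_class :: "nat \<Rightarrow> nat \<Rightarrow> ((nat \<Rightarrow> real) \<Rightarrow> real) \<Rightarrow> bool" where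
  "C_class d 0 f \<longleftrightarrow>
     continuous_map (product_topology (\<lambda>_. euclideanreal) {..<d}) euclideanreal f"
| "C_class d (Suc r) f \<longleftrightarrow>
     continuous_map (product_topology (\<lambda>_. euclideanreal) {..<d}) euclideanreal f \<and>
     (\<forall>i<d. (\<forall>x \<in> {..<d} \<rightarrow>\<^sub>E UNIV. (\<lambda>t. f (x(i := t))) field_differentiable at (x i)) \<and>
            C_class d r (partial_deriv i f))"

definition torus_C_class :: "nat \<Rightarrow> nat \<Rightarrow> ((nat \<Rightarrow> circle) \<Rightarrow> real) \<Rightarrow> bool"
  where "torus_C_class d r \<phi> \<longleftrightarrow> C_class d r (\<lambda>x. \<phi> (to_torus d x))"

definition set_diam :: "'a metric \<Rightarrow> 'a set \<Rightarrow> ennreal"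
  where "set_diam m U = (SUP x\<in>U. SUP y\<in>U. ennreal (mdist m x y))"

text \<open>
  The conversion to \<^typ>\<open>real\<close> is harmless, since only sets of diameter at most \<open>\<delta>\<close> occur. The
  measure is used for \<open>s > 0\<close> only, where \<open>0 powr s = 0\<close> is the correct contribution of empty sets
  and of singletons.
\<close>

definition hausdorff_premeasure :: "'a metric \<Rightarrow> real \<Rightarrow> real \<Rightarrow> 'a set \<Rightarrow> ennreal"
  where "hausdorff_premeasure m s \<delta> A =
    (INF U \<in> {U :: nat \<Rightarrow> 'a set. A \<subseteq> (\<Union>n. U n) \<and> (\<forall>n. U n \<subseteq> mspace m \<and> set_diam m (U n) \<le> ennreal \<delta>)}.
       \<Sum>n. ennreal (enn2real (set_diam m (U n)) powr s))"

definition hausdorff_measure :: "'a metric \<Rightarrow> real \<Rightarrow> 'a set \<Rightarrow> ennreal"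
  where "hausdorff_measure m s A = (SUP \<delta>\<in>{0<..}. hausdorff_premeasure m s \<delta> A)"

definition hausdorff_dim :: "'a metric \<Rightarrow> 'a set \<Rightarrow> ennreal"
  where "hausdorff_dim m A = (INF s \<in> {s. s > 0 \<and> hausdorff_measure m s A = 0}. ennreal s)"

definition int_iterate :: "'a set \<Rightarrow> ('a \<Rightarrow> 'a) \<Rightarrow> int \<Rightarrow> 'a \<Rightarrow> 'a"
  where "int_iterate X T n =
    (if n \<ge> 0 then T ^^ nat n else (inv_into X T) ^^ nat (- n))"

definition full_orbit :: "'a set \<Rightarrow> ('a \<Rightarrow> 'a) \<Rightarrow> 'a \<Rightarrow> 'a set"
  where "full_orbit X T x = range (\<lambda>n. int_iterate X T n x)"

definition dense_orbit :: "'a topology \<Rightarrow> ('a \<Rightarrow> 'a) \<Rightarrow> 'a \<Rightarrow> bool"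
  where "dense_orbit X T x \<longleftrightarrow> X closure_of (full_orbit (topspace X) T x) = topspace X"

definition minimal_map :: "'a topology \<Rightarrow> ('a \<Rightarrow> 'a) \<Rightarrow> bool"
  where "minimal_map X T \<longleftrightarrow> (\<forall>x\<in>topspace X. dense_orbit X T x)"

definition birkhoff_sum :: "'a set \<Rightarrow> ('a \<Rightarrow> 'a) \<Rightarrow> ('a \<Rightarrow> real) \<Rightarrow> int \<Rightarrow> 'a \<Rightarrow> real"
  where "birkhoff_sum X T \<phi> n x =
    (if n \<ge> 0 then (\<Sum>k = 0..<n. \<phi> (int_iterate X T k x))
     else - (\<Sum>k = 1..\<bar>n\<bar>. \<phi> (int_iterate X T (- k) x)))"

definition cylindrical :: "('a \<Rightarrow> 'a) \<Rightarrow> ('a \<Rightarrow> real) \<Rightarrow> 'a \<times> real \<Rightarrow> 'a \<times> real"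
  where "cylindrical T \<phi> = (\<lambda>(x, t). (T x, t + \<phi> x))"

text \<open>The filter \<open>filtercomap abs at_top\<close> on \<^typ>\<open>int\<close> expresses \<open>\<bar>n\<bar> \<rightarrow> \<infinity>\<close>.\<close>

definition discrete_orbit :: "'a set \<Rightarrow> ('a \<Rightarrow> 'a) \<Rightarrow> ('a \<Rightarrow> real) \<Rightarrow> 'a \<times> real \<Rightarrow> bool"
  where "discrete_orbit X T \<phi> = (\<lambda>(x, t).
    filterlim (\<lambda>n. \<bar>birkhoff_sum X T \<phi> n x\<bar>) at_top (filtercomap abs at_top))"

definition besicovitch :: "'a topology \<Rightarrow> ('a \<Rightarrow> 'a) \<Rightarrow> ('a \<Rightarrow> real) \<Rightarrow> bool"
  where "besicovitch X T \<phi> \<longleftrightarrow>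
    (\<exists>p \<in> topspace X \<times> UNIV. dense_orbit (prod_topology X euclideanreal) (cylindrical T \<phi>) p) \<and>
    (\<exists>p \<in> topspace X \<times> UNIV. discrete_orbit (topspace X) T \<phi> p)"

definition D_plus_plus :: "nat \<Rightarrow> (nat \<Rightarrow> circle) \<Rightarrow> ((nat \<Rightarrow> circle) \<Rightarrow> real) \<Rightarrow> (nat \<Rightarrow> circle) set"
  where "D_plus_plus d \<alpha> \<phi> = {x \<in> torus d.
    filterlim (\<lambda>m. birkhoff_sum (torus d) (torus_rotation d \<alpha>) \<phi> m x) at_top (filtercomap abs at_top)}"

end

theory Submission
  imports Defs "HOL-Number_Theory.Fib"
begin

text \<open>
  The function is \<open>\<phi> = \<Sum>\<^sub>j (u\<^sub>j \<circ> T - u\<^sub>j)\<close> with \<open>u\<^sub>j x = c\<^sub>j (1 - cos (2 \<pi> q\<^sub>j x\<^sub>i))\<close> and \<open>i = j mod d\<close>, a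
  series of coboundaries that converges in \<open>C\<^sup>r\<close> although the transfer functions do not. Every \<open>u\<^sub>j\<close> is
  minimal at 0, so the Birkhoff sum \<open>\<Sum>\<^sub>j u\<^sub>j (n \<alpha>)\<close> of \<open>\<phi>\<close> at 0 has only nonnegative terms, for \<open>n\<close> of either
  sign. Take \<open>q\<^sub>j = 2 ^ m j\<close> with \<open>m\<close> the Fibonacci sequence, and let the binary digits of \<open>\<alpha>\<^sub>i\<close> be 1 exactly
  at the places \<open>m (i + d k)\<close>. Then \<open>u\<^sub>j (n \<alpha>)\<close> has in \<open>n\<close> a quasi-period of about \<open>P\<^sub>j = 2 ^ (m (j + d) - m j)\<close>.
  As \<open>P\<^sub>j\<close> grows by an exponent less than 2 from \<open>j - 1\<close> to \<open>j\<close>, the \<open>j\<close>-th term can be made large for all \<open>n\<close>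
  between \<open>P\<^sub>j\<^sub>-\<^sub>1\<close> and \<open>P\<^sub>j\<close>; the factor \<open>q\<^sub>j\<^sup>r\<close> lost by differentiation is absorbed if \<open>d\<close> is large in
  terms of \<open>r\<close>. Hence the Birkhoff sums at 0 tend to infinity.

  One more rationally independent coordinate, on which \<open>\<phi>\<close> does not depend, puts a whole circle into
  \<open>D\<^sup>+\<^sup>+\<close>.

  For a dense orbit, write \<open>\<psi> n\<close> for the \<open>n\<close>-th Birkhoff sum. The difference
  \<open>\<psi> n (z + k \<alpha>) - \<psi> n z = \<psi> k (z + n \<alpha>) - \<psi> k z\<close> is small when \<open>k\<close> is bounded and \<open>n \<alpha>\<close> is close to 0. So
  the value 0, which \<open>\<psi> n\<close> attains because of mean zero, and the large value at 0 are almost attained in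
  every ball, and the intermediate value theorem yields all values in between. This is topological
  transitivity; Baire's theorem concludes.
\<close>

section \<open>Trigonometric series and coboundaries\<close>

text \<open>The free phase makes this family closed under differentiation: a derivative multiplies
  the amplitudes by the frequencies and advances the phases by a quarter turn.\<close>

definition trig_series :: "(nat \<Rightarrow> real) \<Rightarrow> (nat \<Rightarrow> real) \<Rightarrow> (nat \<Rightarrow> real) \<Rightarrow> real \<Rightarrow> real"
  where "trig_series A \<omega> \<beta> t = (\<Sum>k. A k * sin (\<omega> k * t + \<beta> k))"

lemma abs_mult_sin_le: "\<bar>a * sin x\<bar> \<le> \<bar>a\<bar>" for a x :: real
  using mult_left_mono[OF abs_sin_le_one, of "\<bar>a\<bar>" x] by (simp add: abs_mult)

lemma summable_trig_series:
  fixes A :: "nat \<Rightarrow> real"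
  assumes "summable (\<lambda>k. \<bar>A k\<bar>)"
  shows "summable (\<lambda>k. A k * sin (\<omega> k * t + \<beta> k))"
  by (rule summable_comparison_test'[OF assms]) (simp add: abs_mult_sin_le)

lemma continuous_on_trig_series:
  assumes "summable (\<lambda>k. \<bar>A k\<bar>)"
  shows "continuous_on UNIV (trig_series A \<omega> \<beta>)"
  unfolding trig_series_def
  by (rule uniform_limit_theorem[OF _ Weierstrass_m_test[OF _ assms]])
    (auto intro!: always_eventually continuous_intros simp: abs_mult_sin_le)

lemma has_field_derivative_trig_series:
  assumes A: "summable (\<lambda>k. \<bar>A k\<bar>)" and A': "summable (\<lambda>k. \<bar>A k * \<omega> k\<bar>)"
  shows "(trig_series A \<omega> \<beta> has_field_derivative
      trig_series (\<lambda>k. A k * \<omega> k) \<omega> (\<lambda>k. \<beta> k + pi / 2) t) (at t)"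
proof -
  have "((\<lambda>t. \<Sum>k. A k * sin (\<omega> k * t + \<beta> k)) has_field_derivative
      (\<Sum>k. (A k * \<omega> k) * sin (\<omega> k * t + (\<beta> k + pi / 2)))) (at t)"
  proof (rule has_field_derivative_series'(2)[where S = UNIV and ?x0.0 = 0 and
        f = "\<lambda>k t. A k * sin (\<omega> k * t + \<beta> k)" and
        f' = "\<lambda>k t. (A k * \<omega> k) * sin (\<omega> k * t + (\<beta> k + pi / 2))"])
    show "uniformly_convergent_on UNIV
        (\<lambda>n x. \<Sum>i<n. (A i * \<omega> i) * sin (\<omega> i * x + (\<beta> i + pi / 2)))"
      by (rule Weierstrass_m_test'[OF _ A']) (simp add: abs_mult_sin_le del: abs_mult)
    show "((\<lambda>x. A n * sin (\<omega> n * x + \<beta> n)) has_real_derivative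
          A n * \<omega> n * sin (\<omega> n * x + (\<beta> n + pi / 2))) (at x within UNIV)" for n x
      by (auto intro!: derivative_eq_intros simp: sin_add) (simp add: algebra_simps sin_add cos_add)
  qed (use summable_trig_series[OF A, of \<omega> 0 \<beta>] in auto)
  then show ?thesis by (simp add: trig_series_def[abs_def])
qed

lemma trig_series_lipschitz:
  assumes A: "summable (\<lambda>k. \<bar>A k\<bar>)" and A': "summable (\<lambda>k. \<bar>A k * \<omega> k\<bar>)"
  shows "\<bar>trig_series A \<omega> \<beta> t - trig_series A \<omega> \<beta> s\<bar> \<le> (\<Sum>k. \<bar>A k * \<omega> k\<bar>) * \<bar>t - s\<bar>"
proof -
  note s = summable_trig_series[OF A, of \<omega> _ \<beta>]
  have b: "norm (A k * sin (\<omega> k * t + \<beta> k) - A k * sin (\<omega> k * s + \<beta> k)) \<le> \<bar>A k * \<omega> k\<bar> * \<bar>t - s\<bar>" for k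
  proof -
    have "\<bar>sin x - sin y\<bar> \<le> \<bar>x - y\<bar>" for x y :: real
    proof -
      have "sin x - sin y = 2 * sin ((x - y) / 2) * cos ((x + y) / 2)"
        by (rule sin_diff_sin)
      then have "\<bar>sin x - sin y\<bar> = 2 * \<bar>sin ((x - y) / 2)\<bar> * \<bar>cos ((x + y) / 2)\<bar>"
        by (simp add: abs_mult)
      also have "\<dots> \<le> 2 * \<bar>(x - y) / 2\<bar> * 1"
        by (intro mult_mono) (auto simp: abs_sin_x_le_abs_x simp del: abs_divide)
      finally show ?thesis by simp
    qed
    from this[of "\<omega> k * t + \<beta> k" "\<omega> k * s + \<beta> k"]
    have "\<bar>sin (\<omega> k * t + \<beta> k) - sin (\<omega> k * s + \<beta> k)\<bar> \<le> \<bar>\<omega> k\<bar> * \<bar>t - s\<bar>"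
      by (simp flip: abs_mult add: algebra_simps)
    from mult_left_mono[OF this, of "\<bar>A k\<bar>"] show ?thesis
      by (simp add: abs_mult right_diff_distrib[symmetric])
  qed
  have "trig_series A \<omega> \<beta> t - trig_series A \<omega> \<beta> s =
      (\<Sum>k. A k * sin (\<omega> k * t + \<beta> k) - A k * sin (\<omega> k * s + \<beta> k))"
    unfolding trig_series_def by (rule suminf_diff[OF s s])
  also have "norm \<dots> \<le> (\<Sum>k. \<bar>A k * \<omega> k\<bar> * \<bar>t - s\<bar>)"
    using b by (intro norm_suminf_le summable_mult2[OF A']) 
  also have "\<dots> = (\<Sum>k. \<bar>A k * \<omega> k\<bar>) * \<bar>t - s\<bar>"
    by (rule suminf_mult2[OF A', symmetric])
  finally show ?thesis by simp
qed

section \<open>Smoothness of trigonometric series and of sums with separated variables\<close>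

fun Cr_real :: "nat \<Rightarrow> (real \<Rightarrow> real) \<Rightarrow> bool" where
  "Cr_real 0 h \<longleftrightarrow> continuous_on UNIV h"
| "Cr_real (Suc r) h \<longleftrightarrow> (\<exists>h'. (\<forall>t. (h has_field_derivative h' t) (at t)) \<and> Cr_real r h')"

lemma Cr_real_imp_continuous: "Cr_real r h \<Longrightarrow> continuous_on UNIV h"
  by (cases r) (auto intro: DERIV_continuous_on)

lemma Cr_real_zero: "Cr_real r (\<lambda>_. 0)"
  by (induction r) (auto intro!: exI[of _ "\<lambda>_. 0"])

text \<open>Frequencies of at least 1 make the sum weighted by \<open>\<omega> k ^ r\<close>
  dominate those of lower order. So termwise differentiation is justified, and each one lowers the
  order by 1.\<close>

lemma Cr_real_trig_series:
  assumes "\<And>k. \<omega> k \<ge> 1" "summable (\<lambda>k. \<bar>A k\<bar> * \<omega> k ^ r)"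
  shows "Cr_real r (trig_series A \<omega> \<beta>)"
  using assms(2)
proof (induction r arbitrary: A \<beta>)
  case 0
  then show ?case by (simp add: continuous_on_trig_series)
next
  case (Suc r)
  have pos: "\<omega> k \<ge> 0" for k using assms(1)[of k] by simp
  have le: "x \<le> x * \<omega> k" if "x \<ge> 0" for x k
    using mult_left_mono[OF assms(1)[of k] that] by simp
  have ge1: "\<omega> k ^ r \<ge> 1" for k using one_le_power[OF assms(1)] .
  have "\<bar>A k * \<omega> k\<bar> \<le> \<bar>A k\<bar> * \<omega> k ^ Suc r" for k
    using mult_left_mono[OF ge1[of k], of "\<bar>A k * \<omega> k\<bar>"] pos[of k]
    by (simp add: abs_mult mult_ac)
  then have 1: "summable (\<lambda>k. \<bar>A k * \<omega> k\<bar>)"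
    by (intro summable_comparison_test'[OF Suc.prems]) auto
  have "\<bar>A k\<bar> \<le> \<bar>A k * \<omega> k\<bar>" for k
    using le[of "\<bar>A k\<bar>" k] pos[of k] by (simp add: abs_mult)
  then have 0: "summable (\<lambda>k. \<bar>A k\<bar>)"
    by (intro summable_comparison_test'[OF 1]) auto
  have "Cr_real r (trig_series (\<lambda>k. A k * \<omega> k) \<omega> (\<lambda>k. \<beta> k + pi / 2))"
    using Suc.prems pos by (intro Suc.IH) (simp add: abs_mult mult_ac)
  then show ?case
    using has_field_derivative_trig_series[OF 0 1] by auto
qed

text \<open>Mixed derivatives vanish: the partial derivative in direction \<open>j\<close> is again
  a separated sum, with \<open>h' j\<close> at place \<open>j\<close> and 0 elsewhere. Hence the
  induction over all \<open>h\<close>.\<close>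

lemma C_class_separated:
  assumes "\<And>i. i < d \<Longrightarrow> Cr_real r (h i)"
  shows "C_class d r (\<lambda>x. \<Sum>i<d. h i (x i))"
  using assms
proof (induction r arbitrary: h)
  have cont: "continuous_map (product_topology (\<lambda>_. euclideanreal) {..<d}) euclideanreal
      (\<lambda>x. \<Sum>i<d. h i (x i))" if "\<And>i. i < d \<Longrightarrow> Cr_real r (h i)" for h r
  proof (intro continuous_map_sum)
    fix i assume i: "i \<in> {..<d}"
    have "continuous_map euclideanreal euclideanreal (h i)"
      using Cr_real_imp_continuous[OF that] i by simp
    with i show "continuous_map (product_topology (\<lambda>_. euclideanreal) {..<d}) euclideanreal (\<lambda>x. h i (x i))"
      by (intro continuous_map_compose[OF continuous_map_product_projection, unfolded o_def]) auto
  qed auto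
  {
    case 0
    then show ?case using cont[of 0 h] by simp
  next
    case (Suc r)
    obtain h' where h': "\<And>i t. i < d \<Longrightarrow> (h i has_field_derivative h' i t) (at t)"
        "\<And>i. i < d \<Longrightarrow> Cr_real r (h' i)"
      using Suc.prems unfolding Cr_real.simps by metis
    have der: "((\<lambda>t. \<Sum>i<d. h i ((x(j := t)) i)) has_field_derivative h' j s) (at s)" if "j < d" for j x s
    proof -
      have "((\<lambda>t. \<Sum>i<d. h i ((x(j := t)) i)) has_field_derivative (\<Sum>i<d. if i = j then h' j s else 0)) (at s)"
        by (rule DERIV_sum) (auto simp: h'(1) that)
      then show ?thesis using that by simp
    qed
    have "partial_deriv j (\<lambda>x. \<Sum>i<d. h i (x i)) = (\<lambda>x. \<Sum>i<d. (if i = j then h' j else (\<lambda>_. 0)) (x i))"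
      if "j < d" for j
    proof
      fix x :: "nat \<Rightarrow> real"
      have "(\<Sum>i<d. (if i = j then h' j else (\<lambda>_. 0)) (x i)) = (\<Sum>i<d. if i = j then h' j (x j) else 0)"
        by (rule sum.cong) auto
      then show "partial_deriv j (\<lambda>x. \<Sum>i<d. h i (x i)) x = (\<Sum>i<d. (if i = j then h' j else (\<lambda>_. 0)) (x i))"
        using der[OF that, of x "x j"] that by (simp add: partial_deriv_def DERIV_imp_deriv)
    qed
    moreover have "C_class d r (\<lambda>x. \<Sum>i<d. (if i = j then h' j else (\<lambda>_. 0)) (x i))" if "j < d" for j
      by (rule Suc.IH) (auto simp: h'(2) Cr_real_zero that)
    moreover have "(\<lambda>t. \<Sum>i<d. h i ((x(j := t)) i)) field_differentiable (at (x j))" if "j < d" for j x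
      using der[OF that] unfolding field_differentiable_def by blast
    ultimately show ?case
      using cont[OF Suc.prems] by (simp del: fun_upd_apply)
  }
qed

section \<open>Series of coboundaries\<close>

lemma abs_sin_nat_mult_le: "\<bar>sin (real n * x)\<bar> \<le> real n * \<bar>sin x\<bar>"
proof (induction n)
  case (Suc n)
  have 1: "\<bar>sin (real (Suc n) * x)\<bar> = \<bar>sin x * cos (real n * x) + cos x * sin (real n * x)\<bar>"
    by (simp only: of_nat_Suc distrib_right sin_add mult_1_left)
  have 2: "\<dots> \<le> \<bar>sin x\<bar> * \<bar>cos (real n * x)\<bar> + \<bar>cos x\<bar> * \<bar>sin (real n * x)\<bar>" 
    using abs_triangle_ineq[of "sin x * cos (real n * x)" "cos x * sin (real n * x)"]
    by (simp only: abs_mult)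
  have 3: "\<bar>sin x\<bar> * \<bar>cos (real n * x)\<bar> + \<bar>cos x\<bar> * \<bar>sin (real n * x)\<bar> \<le> \<bar>sin x\<bar> * 1 + 1 * \<bar>sin (real n * x)\<bar>"
    by (intro add_mono mult_mono abs_sin_le_one abs_cos_le_one order_refl) simp_all
  have 4:  "\<bar>sin x\<bar> * 1 + 1 * \<bar>sin (real n * x)\<bar> \<le> real (Suc n) * \<bar>sin x\<bar>"
    using Suc.IH by (simp only: of_nat_Suc distrib_right mult_1_left mult_1_right)
  show ?case using 1 2 3 4 by linarith
next
  case 0
  show ?case by simp
qed

lemma abs_sin_int_mult_le:
  fixes x :: real
  shows "\<bar>sin (of_int n * x)\<bar> \<le> of_int \<bar>n\<bar> * \<bar>sin x\<bar>"
proof (cases "n \<ge> 0")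
  case True
  then show ?thesis using abs_sin_nat_mult_le[of "nat n" x] by simp
next
  case False
  then have "of_int n * x = - (real (nat (- n)) * x)" "of_int \<bar>n\<bar> = real (nat (- n))"
    by simp_all
  then show ?thesis using abs_sin_nat_mult_le[of "nat (- n)" x] by (simp only: sin_minus abs_minus_cancel)
qed

text \<open>\<open>coboundary_sum c q a\<close> is \<open>\<Sum>\<^sub>k (u\<^sub>k (t + a) - u\<^sub>k t)\<close> for \<open>u\<^sub>k t = c k * (1 - cos (2 \<pi> q k t))\<close>;
  the single coboundaries are summable although the transfer functions are not.\<close>

definition coboundary_sum :: "(nat \<Rightarrow> real) \<Rightarrow> (nat \<Rightarrow> nat) \<Rightarrow> real \<Rightarrow> real \<Rightarrow> real"
  where "coboundary_sum c q a t =
    (\<Sum>k. c k * (cos (2 * pi * real (q k) * t) - cos (2 * pi * real (q k) * (t + a))))"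

text \<open>The \<open>k\<close>-th coboundary has amplitude
  \<open>2 * c k * sin (pi * q k * a)\<close>, so up to a constant factor the series is that of the
  amplitudes of the \<open>r\<close>-th derivatives. The sine is small when \<open>q k * a\<close>
  is close to an integer, which leaves room for growing weights.\<close>

definition admissible :: "nat \<Rightarrow> (nat \<Rightarrow> real) \<Rightarrow> (nat \<Rightarrow> nat) \<Rightarrow> real \<Rightarrow> bool"
  where "admissible r c q a \<longleftrightarrow> (\<forall>k. c k \<ge> 0) \<and> (\<forall>k. q k \<ge> 1) \<and>
    summable (\<lambda>k. c k * real (q k) ^ r * \<bar>sin (pi * real (q k) * a)\<bar>)"

text \<open>Needed for the Birkhoff sums, which are coboundary sums with rotation number
  \<open>n * a\<close>. The reason is |sin (n x)| \<le> |n| |sin x|.\<close>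

lemma admissible_int_mult:
  assumes "admissible r c q a"
  shows "admissible r c q (of_int n * a)"
proof -
  let ?g = "\<lambda>k. c k * real (q k) ^ r * \<bar>sin (pi * real (q k) * a)\<bar>"
  have cq: "c k * real (q k) ^ r \<ge> 0" for k using assms by (simp add: admissible_def)
  have "summable ?g" using assms by (simp add: admissible_def)
  then have g: "summable (\<lambda>k. of_int \<bar>n\<bar> * ?g k)" by (rule summable_mult)
  have "norm (c k * real (q k) ^ r * \<bar>sin (pi * real (q k) * (of_int n * a))\<bar>) \<le> of_int \<bar>n\<bar> * ?g k" for k
  proof -
    have eq: "pi * real (q k) * (of_int n * a) = of_int n * (pi * real (q k) * a)"
      by (simp only: mult_ac)
    have "norm (c k * real (q k) ^ r * \<bar>sin (pi * real (q k) * (of_int n * a))\<bar>) =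
        c k * real (q k) ^ r * \<bar>sin (of_int n * (pi * real (q k) * a))\<bar>"
      unfolding eq real_norm_def by (rule abs_of_nonneg[OF mult_nonneg_nonneg[OF cq abs_ge_zero]])
    moreover have "c k * real (q k) ^ r * \<bar>sin (of_int n * (pi * real (q k) * a))\<bar> \<le>
        c k * real (q k) ^ r * (of_int \<bar>n\<bar> * \<bar>sin (pi * real (q k) * a)\<bar>)"
      by (rule mult_left_mono[OF abs_sin_int_mult_le cq])
    moreover have "c k * real (q k) ^ r * (of_int \<bar>n\<bar> * \<bar>sin (pi * real (q k) * a)\<bar>) = of_int \<bar>n\<bar> * ?g k"
      by (simp only: mult_ac)
    ultimately show ?thesis by (simp only:)
  qed
  then have "summable (\<lambda>k. c k * real (q k) ^ r * \<bar>sin (pi * real (q k) * (of_int n * a))\<bar>)"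
    by (rule summable_comparison_test'[OF g])
  then show ?thesis using assms unfolding admissible_def by blast
qed

lemma admissible_mono:
  assumes "admissible r c q a" "s \<le> r"
  shows "admissible s c q a"
proof -
  have c: "c k \<ge> 0" and q: "real (q k) \<ge> 1" for k using assms by (simp_all add: admissible_def)
  have "norm (c k * real (q k) ^ s * \<bar>sin (pi * real (q k) * a)\<bar>) \<le>
      c k * real (q k) ^ r * \<bar>sin (pi * real (q k) * a)\<bar>" for k
  proof -
    have nn: "c k * real (q k) ^ s \<ge> 0" using c[of k] by simp
    have "norm (c k * real (q k) ^ s * \<bar>sin (pi * real (q k) * a)\<bar>) =
        c k * real (q k) ^ s * \<bar>sin (pi * real (q k) * a)\<bar>"
      unfolding real_norm_def by (rule abs_of_nonneg[OF mult_nonneg_nonneg[OF nn abs_ge_zero]])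
    also have "\<dots> \<le> c k * real (q k) ^ r * \<bar>sin (pi * real (q k) * a)\<bar>"
      by (rule mult_right_mono[OF mult_left_mono[OF power_increasing[OF assms(2) q] c] abs_ge_zero])
    finally show ?thesis .
  qed
  note le = this
  have sr: "summable (\<lambda>k. c k * real (q k) ^ r * \<bar>sin (pi * real (q k) * a)\<bar>)"
    using assms unfolding admissible_def by blast
  have "summable (\<lambda>k. c k * real (q k) ^ s * \<bar>sin (pi * real (q k) * a)\<bar>)"
    by (rule summable_comparison_test'[OF sr le])
  then show ?thesis using assms unfolding admissible_def by blast
qed

lemma coboundary_term_eq:
  "c * (cos (2 * pi * q * t) - cos (2 * pi * q * (t + a))) =
    (2 * c * sin (pi * q * a)) * sin ((2 * pi * q) * t + pi * q * a)" for c q t a :: real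
proof -
  have "cos (2 * pi * q * t) - cos (2 * pi * q * (t + a)) =
      2 * sin ((2 * pi * q * t + 2 * pi * q * (t + a)) / 2) * sin ((2 * pi * q * (t + a) - 2 * pi * q * t) / 2)"
    by (rule cos_diff_cos)
  also have "(2 * pi * q * t + 2 * pi * q * (t + a)) / 2 = (2 * pi * q) * t + pi * q * a"
    by (simp add: field_simps)
  also have "(2 * pi * q * (t + a) - 2 * pi * q * t) / 2 = pi * q * a"
    by (simp add: field_simps)
  finally show ?thesis by simp
qed

lemma coboundary_sum_trig:
  "coboundary_sum c q a = trig_series (\<lambda>k. 2 * c k * sin (pi * real (q k) * a)) (\<lambda>k. 2 * pi * real (q k))
      (\<lambda>k. pi * real (q k) * a)"
  by (rule ext) (simp add: coboundary_sum_def trig_series_def coboundary_term_eq)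

lemma admissible_trig_summable:
  assumes "admissible r c q a"
  shows "summable (\<lambda>k. \<bar>2 * c k * sin (pi * real (q k) * a)\<bar> * (2 * pi * real (q k)) ^ r)"
proof -
  have "summable (\<lambda>k. (2 * (2 * pi) ^ r) * (c k * real (q k) ^ r * \<bar>sin (pi * real (q k) * a)\<bar>))"
    using assms by (intro summable_mult) (simp add: admissible_def)
  then show ?thesis
    using assms by (simp add: admissible_def abs_mult power_mult_distrib mult_ac)
qed

lemma coboundary_term_summable:
  assumes "admissible r c q a"
  shows "summable (\<lambda>k. c k * (cos (2 * pi * real (q k) * t) - cos (2 * pi * real (q k) * (t + a))))"
  using admissible_trig_summable[OF admissible_mono[OF assms, of 0]]
  unfolding coboundary_term_eq by (intro summable_trig_series) simp

lemma Cr_real_coboundary_sum: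
  assumes "admissible r c q a"
  shows "Cr_real r (coboundary_sum c q a)"
  unfolding coboundary_sum_trig
proof (rule Cr_real_trig_series[OF _ admissible_trig_summable[OF assms]])
  fix k
  have "real (q k) \<ge> 1" using assms by (simp add: admissible_def)
  then show "2 * pi * real (q k) \<ge> 1"
    using pi_gt3 mult_mono[of 1 "2 * pi" 1 "real (q k)"] by simp
qed

text \<open>The transfer functions telescope, term by term because their own series need not
  converge. This is the source of the cocycle identity.\<close>

lemma coboundary_sum_add:
  assumes "admissible r c q a" "admissible r c q b"
  shows "coboundary_sum c q (a + b) t = coboundary_sum c q a t + coboundary_sum c q b (t + a)"
  unfolding coboundary_sum_def
    suminf_add[OF coboundary_term_summable[OF assms(1)] coboundary_term_summable[OF assms(2)]]
  by (rule suminf_cong) (simp add: algebra_simps)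

lemma cos_of_nat_shift_int: "cos (2 * pi * real q * (t + of_int m)) = cos (2 * pi * real q * t)"
  using cos_add[of "2 * pi * real q * t" "2 * pi * of_int (int q * m)"]
    cos_int_2pin[of "int q * m"] sin_int_2pin[of "int q * m"]
  by (simp add: algebra_simps)

lemma coboundary_sum_shift_int:
  "coboundary_sum c q a (t + of_int m) = coboundary_sum c q a t"
proof -
  have "t + of_int m + a = (t + a) + of_int m" by simp
  then show ?thesis
    unfolding coboundary_sum_def by (simp only: cos_of_nat_shift_int)
qed

lemma coboundary_sum_lipschitz:
  assumes "admissible (Suc 0) c q a"
  shows "\<exists>L\<ge>0. \<forall>s t. \<bar>coboundary_sum c q a t - coboundary_sum c q a s\<bar> \<le> L * \<bar>t - s\<bar>"
proof -
  have 0: "summable (\<lambda>k. \<bar>2 * c k * sin (pi * real (q k) * a)\<bar>)"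
    using admissible_trig_summable[OF admissible_mono[OF assms, of 0]] by simp
  have 1: "summable (\<lambda>k. \<bar>2 * c k * sin (pi * real (q k) * a) * (2 * pi * real (q k))\<bar>)"
    using admissible_trig_summable[OF assms] by (simp add: abs_mult mult_ac)
  show ?thesis
    unfolding coboundary_sum_trig using trig_series_lipschitz[OF 0 1] suminf_nonneg[OF 1]
    by (intro exI[of _ "\<Sum>k. \<bar>2 * c k * sin (pi * real (q k) * a) * (2 * pi * real (q k))\<bar>"]) auto
qed

text \<open>Termwise integration: the amplitudes are divided by the frequencies and the phases moved
  back a quarter turn. The equal end values express the zero mean; they yield the vanishing integral
  and, by the mean value theorem, a zero.\<close>

lemma coboundary_sum_primitive:
  assumes "admissible r c q a"
  obtains p where "\<And>t. (p has_field_derivative coboundary_sum c q a t) (at t)" "p 1 = p 0"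
proof -
  define A where "A k = 2 * c k * sin (pi * real (q k) * a) / (2 * pi * real (q k))" for k
  have q: "real (q k) \<ge> 1" for k using assms by (simp add: admissible_def)
  have w: "2 * pi * real (q k) \<ge> 1" for k
    using pi_gt3 mult_mono[of 1 "2 * pi" 1 "real (q k)"] q[of k] by simp
  have Aw: "A k * (2 * pi * real (q k)) = 2 * c k * sin (pi * real (q k) * a)" for k
    using w[of k] q[of k] by (simp add: A_def)
  have 1: "summable (\<lambda>k. \<bar>A k * (2 * pi * real (q k))\<bar>)"
    using admissible_trig_summable[OF admissible_mono[OF assms, of 0]] by (simp add: Aw)
  have "\<bar>A k\<bar> \<le> \<bar>A k * (2 * pi * real (q k))\<bar>" for k
    using mult_left_mono[OF w[of k], of "\<bar>A k\<bar>"] by (simp add: abs_mult)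
  then have 0: "summable (\<lambda>k. \<bar>A k\<bar>)"
    by (intro summable_comparison_test'[OF 1]) auto
  define p where "p = trig_series A (\<lambda>k. 2 * pi * real (q k)) (\<lambda>k. pi * real (q k) * a - pi / 2)"
  have "(p has_field_derivative coboundary_sum c q a t) (at t)" for t
    using has_field_derivative_trig_series[OF 0 1, where \<beta> = "\<lambda>k. pi * real (q k) * a - pi / 2"]
    by (simp add: p_def coboundary_sum_trig Aw)
  moreover have "p 1 = p 0"
  proof -
    have "sin (2 * pi * real (q k) * 1 + x) = sin (2 * pi * real (q k) * 0 + x)" for k x
      using sin_int_2pin[of "int (q k)"] cos_int_2pin[of "int (q k)"] by (simp add: sin_add)
    then show ?thesis by (simp only: p_def trig_series_def)
  qed
  ultimately show ?thesis by (rule that)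
qed

lemma coboundary_sum_has_zero:
  assumes "admissible r c q a"
  shows "\<exists>z. coboundary_sum c q a z = 0"
proof -
  obtain p where p: "\<And>t. (p has_field_derivative coboundary_sum c q a t) (at t)" "p 1 = p 0"
    by (rule coboundary_sum_primitive[OF assms]) blast
  have "\<exists>z>0. z < 1 \<and> p 1 - p 0 = (1 - 0) * coboundary_sum c q a z"
    by (rule MVT2) (simp_all add: p(1))
  then show ?thesis using p(2) by auto
qed

lemma coboundary_sum_integral:
  assumes "admissible r c q a"
  shows "integral {0..1} (coboundary_sum c q a) = 0"
proof -
  obtain p where p: "\<And>t. (p has_field_derivative coboundary_sum c q a t) (at t)" "p 1 = p 0"
    by (rule coboundary_sum_primitive[OF assms]) blast
  have "(coboundary_sum c q a has_integral p 1 - p 0) {0..1}"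
  proof (rule fundamental_theorem_of_calculus)
    show "(p has_vector_derivative coboundary_sum c q a t) (at t within {0..1})" for t
      by (rule has_vector_derivative_at_within)
        (simp add: p(1) flip: has_real_derivative_iff_has_vector_derivative)
  qed simp
  then have "integral {0..1} (coboundary_sum c q a) = p 1 - p 0"
    by (rule integral_unique)
  then show ?thesis by (simp add: p(2))
qed

section \<open>Rotations of the torus and cylindrical transformations\<close>

text \<open>The distance to the nearest integer, that is, the metric of the circle on real lifts.
  The dynamical arguments below work with lifts of torus points.\<close>

abbreviation nrm :: "real \<Rightarrow> real"
  where "nrm u \<equiv> infdist u \<int>"

lemma nrm_less_iff: "nrm u < e \<longleftrightarrow> (\<exists>m::int. \<bar>u - of_int m\<bar> < e)"
proof
  assume "nrm u < e"
  moreover have "(\<int> :: real set) \<noteq> {}" using Ints_0 by blast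
  ultimately obtain z :: real where "z \<in> \<int>" "dist u z < e"
    using infdist_attains_inf[OF closed_Ints_real, of u] by metis
  then show "\<exists>m::int. \<bar>u - of_int m\<bar> < e"
    by (auto simp: dist_real_def elim!: Ints_cases)
next
  assume "\<exists>m::int. \<bar>u - of_int m\<bar> < e"
  then obtain m :: int where "\<bar>u - of_int m\<bar> < e" by blast
  with infdist_le[of "of_int m" "\<int>" u] show "nrm u < e"
    by (simp add: dist_real_def)
qed

lemma nrm_le_abs: "nrm u \<le> \<bar>u\<bar>"
  using infdist_le[of 0 "\<int>" u] by (simp add: dist_real_def)

lemma nrm_minus: "nrm (- u) = nrm u"
  by (rule infdist_Ints_minus)

lemma nrm_shift_int: "nrm (u + of_int m) = nrm u"
  by (rule infdist_Ints_shift) simp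

lemma nrm_add: "nrm (u + v) \<le> nrm u + nrm v"
proof (rule field_le_epsilon)
  fix e :: real assume "e > 0"
  then have "nrm u < nrm u + e / 2" "nrm v < nrm v + e / 2" by simp_all
  then obtain m k :: int where "\<bar>u - of_int m\<bar> < nrm u + e / 2" "\<bar>v - of_int k\<bar> < nrm v + e / 2"
    unfolding nrm_less_iff by blast
  then have "\<bar>(u + v) - of_int (m + k)\<bar> < nrm u + nrm v + e" by simp
  then show "nrm (u + v) \<le> nrm u + nrm v + e"
    using nrm_less_iff less_imp_le by blast
qed

lemma to_circle_add: "to_circle (x + y) = to_circle x + to_circle y"
  by (simp add: plus_circle.abs_eq)

lemma to_circle_rep_circle [simp]: "to_circle (rep_circle z) = z"
  by (rule Quotient_abs_rep[OF Quotient_circle])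

lemma rep_circle_to_circle: "\<exists>m::int. rep_circle (to_circle t) = t + of_int m"
proof -
  have "rep_circle (to_circle t) - t \<in> \<int>"
    by (simp flip: to_circle_eq_iff)
  then obtain m :: int where "rep_circle (to_circle t) - t = of_int m" by (auto elim: Ints_cases)
  then show ?thesis by (intro exI[of _ m]) simp
qed

lemma to_torus_in_torus [simp]: "to_torus D y \<in> torus D"
  by (simp add: to_torus_def torus_def)

lemma to_torus_rep_circle: "x \<in> torus D \<Longrightarrow> to_torus D (\<lambda>i. rep_circle (x i)) = x"
  by (auto simp: to_torus_def torus_def fun_eq_iff PiE_def extensional_def)

lemma to_torus_nth: "i < D \<Longrightarrow> to_torus D y i = to_circle (y i)"
  by (simp add: to_torus_def)

lemma mdist_to_torus_le:
  "mdist (torus_metric D) (to_torus D y) (to_torus D z) \<le> (\<Sum>i<D. nrm (y i - z i))"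
proof -
  have "L2_set (\<lambda>i. dist (to_torus D y i) (to_torus D z i)) {..<D} \<le>
      (\<Sum>i<D. dist (to_torus D y i) (to_torus D z i))"
    by (rule L2_set_le_sum) simp
  then show ?thesis
    by (simp add: mdist_torus_metric to_torus_nth dist_to_circle)
qed

lemma nrm_le_mdist_to_torus:
  assumes "i < D"
  shows "nrm (y i - z i) \<le> mdist (torus_metric D) (to_torus D y) (to_torus D z)"
proof -
  have "dist (to_torus D y i) (to_torus D z i) \<le> L2_set (\<lambda>i. dist (to_torus D y i) (to_torus D z i)) {..<D}"
    by (rule member_le_L2_set) (use assms in auto)
  then show ?thesis
    using assms by (simp add: mdist_torus_metric to_torus_nth dist_to_circle)
qed

lemma openin_torus_topology_ball:
  assumes "openin (torus_topology D) U" "to_torus D y \<in> U"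
  shows "\<exists>e>0. \<forall>z. (\<forall>i<D. nrm (z i - y i) < e) \<longrightarrow> to_torus D z \<in> U"
proof -
  interpret T: Metric_space "mspace (torus_metric D)" "mdist (torus_metric D)"
    by (rule Metric_space_mspace_mdist)
  obtain r where r: "r > 0" "T.mball (to_torus D y) r \<subseteq> U"
    using assms unfolding mtopology_of_def T.openin_mtopology by blast
  show ?thesis
  \<comment> \<open>With the denominator \<open>D + 1\<close> the bound is positive even for
    \<open>D = 0\<close>, and \<open>D\<close> coordinates together stay strictly below
    \<open>r\<close>.\<close>
  proof (intro exI[of _ "r / (D + 1)"] conjI allI impI)
    show "r / (D + 1) > 0" using r by simp
    fix z assume z: "\<forall>i<D. nrm (z i - y i) < r / (D + 1)"
    have "mdist (torus_metric D) (to_torus D y) (to_torus D z) \<le> (\<Sum>i<D. nrm (y i - z i))"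
      by (rule mdist_to_torus_le)
    also have "\<dots> \<le> (\<Sum>i<D. r / (D + 1))"
      using z by (intro sum_mono less_imp_le) (metis lessThan_iff infdist_Ints_minus minus_diff_eq)
    also have "\<dots> < r" using r(1) by (simp add: field_simps)
    finally have "to_torus D z \<in> T.mball (to_torus D y) r"
      unfolding T.in_mball by simp
    then show "to_torus D z \<in> U" using r by blast
  qed
qed

section \<open>Two-sided iterates, Birkhoff sums and density of orbits\<close>

lemma int_iterate_eqI:
  assumes inj: "inj_on T X" and f0: "f 0 = x" and f: "\<And>n. f n \<in> X" and step: "\<And>n. T (f n) = f (n + 1)"
  shows "int_iterate X T n x = f n"
proof (cases "n \<ge> 0")
  case True
  have "(T ^^ k) x = f (int k)" for k
    by (induction k) (simp_all add: f0 step add.commute)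
  from this[of "nat n"] True show ?thesis by (simp add: int_iterate_def)
next
  case False
  have "(inv_into X T ^^ k) x = f (- int k)" for k
  proof (induction k)
    case (Suc k)
    \<comment> \<open>Injectivity on \<open>X\<close> lets \<open>inv_into\<close> undo the forward
      step from index \<open>- int k - 1\<close> to \<open>- int k\<close>.\<close>
    have "inv_into X T (f (- int k)) = f (- int k - 1)"
      using inv_into_f_f[OF inj f, of "- int k - 1"] step[of "- int k - 1"] by simp
    moreover have "- int (Suc k) = - int k - 1" by simp
    ultimately show ?case using Suc by (simp only: funpow.simps o_apply)
  qed (simp add: f0)
  from this[of "nat (- n)"] False show ?thesis by (simp add: int_iterate_def)
qed

text \<open>The convention for negative \<open>n\<close> is the one under which passing from
  \<open>n\<close> to \<open>n + 1\<close> always adds the value at the \<open>n\<close>-th iterate,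
  so sums of either sign telescope.\<close>

lemma birkhoff_sum_eqI:
  fixes g :: "int \<Rightarrow> real"
  assumes "g 0 = 0" and step: "\<And>n. g (n + 1) - g n = \<phi> (int_iterate X T n x)"
  shows "birkhoff_sum X T \<phi> n x = g n"
proof (cases "n \<ge> 0")
  case True
  have "(\<Sum>k = 0..<int m. \<phi> (int_iterate X T k x)) = g (int m)" for m
  proof (induction m)
    case (Suc m)
    have "{0..<int (Suc m)} = insert (int m) {0..<int m}" by auto
    then show ?case using Suc step[of "int m"] by (simp add: add.commute)
  qed (simp add: assms)
  from this[of "nat n"] True show ?thesis by (simp add: birkhoff_sum_def)
next
  case False
  have "(\<Sum>k = 1..int m. \<phi> (int_iterate X T (- k) x)) = - g (- int m)" for m
  proof (induction m)
    case (Suc m)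
    have "{1..int (Suc m)} = insert (1 + int m) {1..int m}" by auto
    then show ?case using Suc step[of "- 1 - int m"] by simp
  qed (simp add: assms)
  from this[of "nat (- n)"] False show ?thesis by (simp add: birkhoff_sum_def)
qed

lemma torus_rotation_to_torus:
  "torus_rotation D (to_torus D a) (to_torus D y) = to_torus D (\<lambda>i. y i + a i)"
  by (auto simp: torus_rotation_def to_torus_def to_circle_add)

lemma inj_on_torus_rotation: "inj_on (torus_rotation D a) (torus D)"
proof (rule inj_onI)
  fix x y assume x: "x \<in> torus D" "y \<in> torus D" and eq: "torus_rotation D a x = torus_rotation D a y"
  have "x i = y i" if "i < D" for i
    using fun_cong[OF eq, of i] that by (simp add: torus_rotation_def)
  with x show "x = y" by (auto simp: torus_def intro: PiE_ext)
qed

lemma int_iterate_torus_rotation: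
  "int_iterate (torus D) (torus_rotation D (to_torus D a)) n (to_torus D y) =
    to_torus D (\<lambda>i. y i + of_int n * a i)"
  by (rule int_iterate_eqI[OF inj_on_torus_rotation, where f = "\<lambda>n. to_torus D (\<lambda>i. y i + of_int n * a i)"])
    (simp_all add: torus_rotation_to_torus algebra_simps)

lemma inj_on_cylindrical:
  assumes "inj_on T X"
  shows "inj_on (cylindrical T \<phi>) (X \<times> UNIV)"
  using assms by (auto simp: inj_on_def cylindrical_def)

lemma int_iterate_cylindrical:
  fixes \<psi> :: "int \<Rightarrow> (nat \<Rightarrow> real) \<Rightarrow> real"
  assumes "\<psi> 0 y = 0" "\<And>n. \<psi> (n + 1) y - \<psi> n y = \<phi> (to_torus D (\<lambda>i. y i + of_int n * a i))"
  shows "int_iterate (torus D \<times> UNIV) (cylindrical (torus_rotation D (to_torus D a)) \<phi>) n (to_torus D y, 0) =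
    (to_torus D (\<lambda>i. y i + of_int n * a i), \<psi> n y)"
  by (rule int_iterate_eqI[OF inj_on_cylindrical[OF inj_on_torus_rotation],
        where f = "\<lambda>n. (to_torus D (\<lambda>i. y i + of_int n * a i), \<psi> n y)"])
    (simp_all add: cylindrical_def torus_rotation_to_torus algebra_simps assms(1) flip: assms(2))

lemma topspace_torus: "topspace (torus_topology D) = torus D"
  by simp

text \<open>Subtracting the starting point from the target reduces every orbit to the orbit of
  0.\<close>

lemma minimal_map_torus_rotation:
  assumes "\<And>y e. e > 0 \<Longrightarrow> \<exists>n::int. \<forall>i<D. nrm (of_int n * a i - y i) < e"
  shows "minimal_map (torus_topology D) (torus_rotation D (to_torus D a))"
  unfolding minimal_map_def dense_orbit_def full_orbit_def topspace_torus
proof (intro ballI subset_antisym subsetI)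
  fix x z assume x: "x \<in> torus D" and z: "z \<in> torus D"
  define y where "y i = rep_circle (x i)" for i
  define w where "w i = rep_circle (z i)" for i
  have y: "x = to_torus D y" and w: "z = to_torus D w"
    using to_torus_rep_circle[OF x] to_torus_rep_circle[OF z] unfolding y_def w_def by simp_all
  show "z \<in> torus_topology D closure_of
      range (\<lambda>n. int_iterate (torus D) (torus_rotation D (to_torus D a)) n x)"
    unfolding in_closure_of
  proof (intro conjI allI impI)
    fix U assume "z \<in> U \<and> openin (torus_topology D) U"
    then have U: "openin (torus_topology D) U" "to_torus D w \<in> U" by (simp_all add: w)
    obtain e where e0: "e > 0 \<and> (\<forall>u. (\<forall>i<D. nrm (u i - w i) < e) \<longrightarrow> to_torus D u \<in> U)"
      using openin_torus_topology_ball[OF U] by (rule exE)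
    have e: "e > 0" "\<And>u. (\<forall>i<D. nrm (u i - w i) < e) \<Longrightarrow> to_torus D u \<in> U"
      using e0[THEN conjunct1] e0[THEN conjunct2, THEN spec, THEN mp] by this
    obtain n :: int where "\<forall>i<D. nrm (of_int n * a i - (w i - y i)) < e"
      using assms[OF e(1), of "\<lambda>i. w i - y i"] by blast
    moreover have "of_int n * a i - (w i - y i) = y i + of_int n * a i - w i" for i by simp
    ultimately have "to_torus D (\<lambda>i. y i + of_int n * a i) \<in> U"
      by (intro e(2)) simp
    then show "\<exists>u. u \<in> range (\<lambda>n. int_iterate (torus D) (torus_rotation D (to_torus D a)) n x) \<and> u \<in> U"
      unfolding y by (auto simp: int_iterate_torus_rotation)
  qed (use z in simp)
qed (simp_all add: in_closure_of)

lemma dense_orbit_cylindrical: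
  fixes \<psi> :: "int \<Rightarrow> (nat \<Rightarrow> real) \<Rightarrow> real"
  assumes \<psi>: "\<psi> 0 y = 0" "\<And>n. \<psi> (n + 1) y - \<psi> n y = \<phi> (to_torus D (\<lambda>i. y i + of_int n * a i))"
    and dense: "\<And>w t e. e > 0 \<Longrightarrow> \<exists>n::int. (\<forall>i<D. nrm (y i + of_int n * a i - w i) < e) \<and> \<bar>\<psi> n y - t\<bar> < e"
  shows "dense_orbit (prod_topology (torus_topology D) euclideanreal)
    (cylindrical (torus_rotation D (to_torus D a)) \<phi>) (to_torus D y, 0)"
  unfolding dense_orbit_def full_orbit_def topspace_prod_topology topspace_torus topspace_euclidean
proof (intro subset_antisym subsetI)
  fix p assume p: "p \<in> torus D \<times> (UNIV :: real set)"
  obtain z t where zt: "p = (z, t)" by fastforce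
  define w where "w i = rep_circle (z i)" for i
  have w: "z = to_torus D w" using p zt to_torus_rep_circle[of z D] unfolding w_def by simp
  let ?T = "cylindrical (torus_rotation D (to_torus D a)) \<phi>"
  show "p \<in> prod_topology (torus_topology D) euclideanreal closure_of
      range (\<lambda>n. int_iterate (torus D \<times> UNIV) ?T n (to_torus D y, 0))"
    unfolding in_closure_of
  proof (intro conjI allI impI)
    fix W assume "p \<in> W \<and> openin (prod_topology (torus_topology D) euclideanreal) W"
    then obtain U V where UV: "openin (torus_topology D) U" "open V" "z \<in> U" "t \<in> V" "U \<times> V \<subseteq> W"
      unfolding openin_prod_topology_alt zt by (metis open_openin)
    obtain e where e0: "e > 0 \<and> (\<forall>u. (\<forall>i<D. nrm (u i - w i) < e) \<longrightarrow> to_torus D u \<in> U)"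
      using openin_torus_topology_ball[OF UV(1) UV(3)[unfolded w]] by (rule exE)
    have e: "e > 0" "\<And>u. (\<forall>i<D. nrm (u i - w i) < e) \<Longrightarrow> to_torus D u \<in> U"
      using e0[THEN conjunct1] e0[THEN conjunct2, THEN spec, THEN mp] by this
    obtain e' where e': "e' > 0" "\<And>s. \<bar>s - t\<bar> < e' \<Longrightarrow> s \<in> V"
      using UV(2,4) unfolding open_dist dist_real_def by blast
    obtain n :: int where n: "\<forall>i<D. nrm (y i + of_int n * a i - w i) < min e e'" "\<bar>\<psi> n y - t\<bar> < min e e'"
      using dense[of "min e e'" w t] e e' by auto
    have "to_torus D (\<lambda>i. y i + of_int n * a i) \<in> U"
      by (intro e(2)) (use n(1) in simp)
    moreover have "\<psi> n y \<in> V" using n(2) e' by simp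
    ultimately have "int_iterate (torus D \<times> UNIV) ?T n (to_torus D y, 0) \<in> W"
      using UV(5) by (auto simp: int_iterate_cylindrical[where \<psi> = \<psi> and \<phi> = \<phi> and a = a and D = D and y = y, OF \<psi>])
    then show "\<exists>u. u \<in> range (\<lambda>n. int_iterate (torus D \<times> UNIV) ?T n (to_torus D y, 0)) \<and> u \<in> W"
      by blast
  qed (use p in simp)
qed (simp_all add: in_closure_of)

section \<open>Hausdorff dimension of sets containing a circle\<close>

lemma mdist_le_set_diam: "x \<in> U \<Longrightarrow> y \<in> U \<Longrightarrow> ennreal (mdist m x y) \<le> set_diam m U"
  unfolding set_diam_def by (intro SUP_upper2[of x U] SUP_upper)

text \<open>Two parameters in \<open>{0..<1}\<close> differ by less than 1, so the integer realising their circle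
  distance is one of -1, 0, 1.\<close>

lemma emeasure_circle_slice_le:
  assumes "\<And>t s. t \<in> V \<Longrightarrow> s \<in> V \<Longrightarrow> nrm (t - s) \<le> \<rho>" "V \<subseteq> {0..<1}" "\<rho> \<ge> 0"
  obtains B where "B \<in> sets lborel" "V \<subseteq> B" "emeasure lborel B \<le> ennreal (6 * \<rho>)"
proof (cases "V = {}")
  case True
  then show ?thesis by (intro that[of "{}"]) simp_all
next
  case False
  then obtain s where s: "s \<in> V" by blast
  let ?I = "\<lambda>m::real. {s + m - \<rho>..s + m + \<rho>}"
  show ?thesis
  proof (rule that)
    show "?I (- 1) \<union> ?I 0 \<union> ?I 1 \<in> sets lborel" by simp
    show "V \<subseteq> ?I (- 1) \<union> ?I 0 \<union> ?I 1"
    proof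
      fix t assume t: "t \<in> V"
      show "t \<in> ?I (- 1) \<union> ?I 0 \<union> ?I 1"
      proof (cases "\<rho> \<ge> 1")
        case True
        moreover have "0 \<le> s" "s < 1" "0 \<le> t" "t < 1" using s t assms(2) by auto
        ultimately show ?thesis by simp
      next
        case False
        have "(\<int> :: real set) \<noteq> {}" using Ints_0 by blast
        then obtain z :: real where z: "z \<in> \<int>" "nrm (t - s) = dist (t - s) z"
          using infdist_attains_inf[OF closed_Ints_real] by metis
        then obtain m :: int where m: "z = of_int m" by (auto elim: Ints_cases)
        have le: "\<bar>t - s - of_int m\<bar> \<le> \<rho>"
          using assms(1)[OF t s] z m by (simp add: dist_real_def)
        have "0 \<le> s" "s < 1" "0 \<le> t" "t < 1" using s t assms(2) by auto
        then have "\<bar>t - s\<bar> < 1" by linarith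
        with le False have "\<bar>of_int m :: real\<bar> < 2" by linarith
        then have "m \<in> {-1, 0, 1}" by force
        then show ?thesis using le by (auto simp: abs_le_iff)
      qed
    qed
    have I: "emeasure lborel (?I m) = ennreal (2 * \<rho>)" for m
      using assms(3) by simp
    have "emeasure lborel (?I (- 1) \<union> ?I 0 \<union> ?I 1) \<le>
        emeasure lborel (?I (- 1)) + emeasure lborel (?I 0) + emeasure lborel (?I 1)"
      by (rule order_trans[OF emeasure_subadditive add_right_mono[OF emeasure_subadditive]]) simp_all
    also have "\<dots> = ennreal (6 * \<rho>)"
      unfolding I using assms(3) by (simp flip: ennreal_plus)
    finally show "emeasure lborel (?I (- 1) \<union> ?I 0 \<union> ?I 1) \<le> ennreal (6 * \<rho>)" .
  qed
qed

text \<open>Lebesgue measure acts as a mass distribution on the circle: the parameters that land in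
  a set of diameter \<rho> \<le> 1 have measure at most 6 \<rho> \<le> 6 \<rho>^s, and a cover has
  to account for the total mass 1.\<close>

lemma hausdorff_premeasure_circle_ge:
  assumes s: "0 < s" "s \<le> 1" and j: "j < D"
    and A: "\<And>t. to_torus D (\<lambda>i. if i = j then t else 0) \<in> A"
  shows "ennreal (1 / 6) \<le> hausdorff_premeasure (torus_metric D) s 1 A"
  unfolding hausdorff_premeasure_def
proof (rule INF_greatest, clarify)
  fix U :: "nat \<Rightarrow> (nat \<Rightarrow> circle) set"
  assume cover: "A \<subseteq> (\<Union>n. U n)"
    and U: "\<forall>n. U n \<subseteq> mspace (torus_metric D) \<and> set_diam (torus_metric D) (U n) \<le> ennreal 1"
  define \<gamma> where "\<gamma> t = to_torus D (\<lambda>i. if i = j then t else 0)" for t :: real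
  define \<rho> where "\<rho> n = enn2real (set_diam (torus_metric D) (U n))" for n
  have \<rho>_eq: "ennreal (\<rho> n) = set_diam (torus_metric D) (U n)" for n
    unfolding \<rho>_def using U by (intro ennreal_enn2real) (metis ennreal_less_top le_less_trans)
  have \<rho>: "0 \<le> \<rho> n" "\<rho> n \<le> 1" for n
  proof -
    show "0 \<le> \<rho> n" by (simp add: \<rho>_def)
    have "ennreal (\<rho> n) \<le> ennreal 1" unfolding \<rho>_eq using U by blast
    then show "\<rho> n \<le> 1" by (simp add: ennreal_le_iff del: ennreal_1)
  qed
  define V where "V n = {t \<in> {0..<1}. \<gamma> t \<in> U n}" for n
  have "\<exists>B. B \<in> sets lborel \<and> V n \<subseteq> B \<and> emeasure lborel B \<le> ennreal (6 * \<rho> n)" for n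
  proof -
    have "nrm (t - r) \<le> \<rho> n" if "t \<in> V n" "r \<in> V n" for t r
    proof -
      have "nrm (t - r) \<le> mdist (torus_metric D) (\<gamma> t) (\<gamma> r)"
        using nrm_le_mdist_to_torus[OF j, of "\<lambda>i. if i = j then t else 0" "\<lambda>i. if i = j then r else 0"]
        by (simp add: \<gamma>_def)
      moreover have "ennreal (mdist (torus_metric D) (\<gamma> t) (\<gamma> r)) \<le> ennreal (\<rho> n)"
        unfolding \<rho>_eq using that by (intro mdist_le_set_diam) (auto simp: V_def)
      ultimately show ?thesis using \<rho>(1)[of n] by simp
    qed
    then show ?thesis
      by (rule emeasure_circle_slice_le[of "V n" "\<rho> n"]) (use \<rho> in \<open>auto simp: V_def\<close>)
  qed
  then obtain B where B: "\<And>n. B n \<in> sets lborel" "\<And>n. V n \<subseteq> B n" "\<And>n. emeasure lborel (B n) \<le> ennreal (6 * \<rho> n)"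
    by metis
  have "{0..<1::real} \<subseteq> (\<Union>n. B n)"
  proof
    fix t :: real assume t: "t \<in> {0..<1}"
    have "\<gamma> t \<in> (\<Union>n. U n)" using cover A by (auto simp: \<gamma>_def)
    then show "t \<in> (\<Union>n. B n)" using t B(2) by (auto simp: V_def)
  qed
  then have "emeasure lborel {0..<1::real} \<le> emeasure lborel (\<Union>n. B n)"
    using B(1) by (intro emeasure_mono) auto
  also have "\<dots> \<le> (\<Sum>n. emeasure lborel (B n))"
    using B(1) by (intro emeasure_subadditive_countably) auto
  also have "\<dots> \<le> (\<Sum>n. ennreal 6 * ennreal (\<rho> n powr s))"
  proof (intro suminf_le allI)
    fix n
    have "\<rho> n \<le> \<rho> n powr s"
    proof (cases "\<rho> n = 0")
      case False
      then show ?thesis using powr_mono'[of s 1 "\<rho> n"] \<rho>[of n] s by simp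
    qed simp
    then have "ennreal (6 * \<rho> n) \<le> ennreal (6 * \<rho> n powr s)" by (intro ennreal_leI) simp
    with B(3)[of n] show "emeasure lborel (B n) \<le> ennreal 6 * ennreal (\<rho> n powr s)"
      by (simp add: ennreal_mult)
  qed auto
  also have "\<dots> = ennreal 6 * (\<Sum>n. ennreal (\<rho> n powr s))"
    by simp
  finally have "ennreal 1 \<le> ennreal 6 * (\<Sum>n. ennreal (\<rho> n powr s))" by simp
  then have "ennreal (1 / 6) * ennreal 1 \<le> ennreal (1 / 6) * (ennreal 6 * (\<Sum>n. ennreal (\<rho> n powr s)))"
    by (rule mult_left_mono) simp
  also have "\<dots> = ennreal (1 / 6 * 6) * (\<Sum>n. ennreal (\<rho> n powr s))"
    by (subst ennreal_mult) (simp_all add: mult.assoc)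
  finally show "ennreal (1 / 6) \<le> (\<Sum>n. ennreal (enn2real (set_diam (torus_metric D) (U n)) powr s))"
    by (simp add: \<rho>_def)
qed

text \<open>No \<open>s\<close> \<le> 1 gives measure 0, so the infimum runs over exponents above 1
  only.\<close>

lemma hausdorff_dim_circle_ge:
  assumes j: "j < D" and A: "\<And>t. to_torus D (\<lambda>i. if i = j then t else 0) \<in> A"
  shows "1 \<le> hausdorff_dim (torus_metric D) A"
  unfolding hausdorff_dim_def
proof (rule INF_greatest, clarify)
  fix s :: real assume s: "0 < s" and 0: "hausdorff_measure (torus_metric D) s A = 0"
  have "hausdorff_premeasure (torus_metric D) s 1 A \<le> hausdorff_measure (torus_metric D) s A"
    unfolding hausdorff_measure_def by (rule SUP_upper) simp
  with 0 have "hausdorff_premeasure (torus_metric D) s 1 A = 0" by simp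
  with hausdorff_premeasure_circle_ge[OF s _ j A] have "\<not> s \<le> 1" by (auto simp: ennreal_eq_0_iff)
  then show "1 \<le> ennreal s" by simp
qed

section \<open>Transitivity of proper cocycles with zeros\<close>

text \<open>A cocycle over a minimal rotation, written on lifts. As \<open>uniformly_cont\<close>
  measures distances by \<open>nrm\<close> and only below \<open>D\<close>, it also contains
  periodicity and independence of the coordinates from \<open>D\<close> on.\<close>

locale proper_cocycle =
  fixes D :: nat and a :: "nat \<Rightarrow> real" and \<psi> :: "int \<Rightarrow> (nat \<Rightarrow> real) \<Rightarrow> real"
  assumes kronecker: "\<And>y e. e > 0 \<Longrightarrow> \<exists>n::int. \<forall>i<D. nrm (of_int n * a i - y i) < e"
    and cocycle: "\<And>n m y. \<psi> (n + m) y = \<psi> n y + \<psi> m (\<lambda>i. y i + of_int n * a i)"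
    and uniformly_cont: "\<And>n e. e > 0 \<Longrightarrow>
      \<exists>\<delta>>0. \<forall>y z. (\<forall>i<D. nrm (y i - z i) < \<delta>) \<longrightarrow> \<bar>\<psi> n y - \<psi> n z\<bar> < e"
    and has_zero: "\<And>n. \<exists>z. \<psi> n z = 0"
    and proper: "\<And>B. \<exists>N. \<forall>n. N \<le> \<bar>n\<bar> \<longrightarrow> B \<le> \<psi> n (\<lambda>_. 0)"
begin

lemma periodic:
  assumes "\<And>i. i < D \<Longrightarrow> nrm (y i - z i) = 0"
  shows "\<psi> n y = \<psi> n z"
proof (rule ccontr)
  assume "\<psi> n y \<noteq> \<psi> n z"
  then obtain \<delta> where "\<delta> > 0" "(\<forall>i<D. nrm (y i - z i) < \<delta>) \<longrightarrow> \<bar>\<psi> n y - \<psi> n z\<bar> < \<bar>\<psi> n y - \<psi> n z\<bar>"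
    using uniformly_cont[of "\<bar>\<psi> n y - \<psi> n z\<bar>" n] by (metis zero_less_abs_iff right_minus_eq)
  then show False using assms by auto
qed

text \<open>Compactness in finite form: \<open>kronecker\<close> is applied to the points of a grid
  of mesh \<open>1 / N < e / 2\<close>, and \<open>K\<close> is the largest of the finitely many
  times obtained.\<close>

lemma syndetic:
  assumes "e > 0"
  shows "\<exists>K. \<forall>y. \<exists>k::int. \<bar>k\<bar> \<le> K \<and> (\<forall>i<D. nrm (of_int k * a i - y i) < e)"
proof -
  obtain N :: nat where N: "N > 0" "1 / real N < e / 2"
    using real_arch_inverse[of "e / 2"] assms by (auto simp: inverse_eq_divide)
  define G where "G = ({..<D} \<rightarrow>\<^sub>E {..<N})"
  have "finite G" unfolding G_def by (intro finite_PiE) simp_all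
  have "\<forall>g. \<exists>k::int. \<forall>i<D. nrm (of_int k * a i - real (g i) / real N) < e / 2"
  proof
    fix g :: "nat \<Rightarrow> nat"
    show "\<exists>k::int. \<forall>i<D. nrm (of_int k * a i - real (g i) / real N) < e / 2"
      using kronecker[of "e / 2" "\<lambda>i. real (g i) / real N"] assms by simp
  qed
  then obtain k :: "(nat \<Rightarrow> nat) \<Rightarrow> int" where
    k: "\<forall>g. \<forall>i<D. nrm (of_int (k g) * a i - real (g i) / real N) < e / 2"
    by (rule choice[THEN exE])
  show ?thesis
  proof (rule exI[of _ "Max ((\<lambda>g. \<bar>k g\<bar>) ` G)"], rule allI)
    fix y :: "nat \<Rightarrow> real"
    \<comment> \<open>The grid point obtained by rounding down the fractional parts of
      \<open>y\<close>; it is within the mesh of \<open>y\<close> modulo 1.\<close>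
    define g where "g = (\<lambda>i\<in>{..<D}. nat \<lfloor>real N * frac (y i)\<rfloor>)"
    have bounds: "0 \<le> real N * frac (y i)" "real N * frac (y i) < real N" for i
      using N(1) by (simp_all add: frac_lt_1)
    have "nat \<lfloor>real N * frac (y i)\<rfloor> < N" for i
      using bounds[of i] N(1) by (simp add: nat_less_iff floor_less_iff)
    then have "g \<in> G" by (auto simp: G_def g_def)
    have "nrm (of_int (k g) * a i - y i) < e" if i: "i < D" for i
    proof -
      have g: "real (g i) = of_int \<lfloor>real N * frac (y i)\<rfloor>"
        using i bounds[of i] by (simp add: g_def)
      have "\<bar>real (g i) - real N * frac (y i)\<bar> \<le> 1"
        unfolding g by linarith
      then have "\<bar>real (g i) - real N * frac (y i)\<bar> / real N \<le> 1 / real N"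
        by (intro divide_right_mono) simp_all
      moreover have "\<bar>real (g i) / real N - frac (y i)\<bar> = \<bar>real (g i) - real N * frac (y i)\<bar> / real N"
      proof -
        have "real (g i) / real N - frac (y i) = (real (g i) - real N * frac (y i)) / real N"
          using N(1) by (simp add: field_simps)
        then show ?thesis by (simp only: abs_divide abs_of_nat)
      qed
      ultimately have "nrm (real (g i) / real N - frac (y i)) < e / 2"
        using nrm_le_abs[of "real (g i) / real N - frac (y i)"] N(2) by linarith
      moreover have "nrm (real (g i) / real N - y i) = nrm (real (g i) / real N - frac (y i))"
        using nrm_shift_int[of "real (g i) / real N - frac (y i)" "- \<lfloor>y i\<rfloor>"] by (simp add: frac_def)
      moreover have "nrm (of_int (k g) * a i - real (g i) / real N) < e / 2" using k i by blast
      ultimately show ?thesis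
        using nrm_add[of "of_int (k g) * a i - real (g i) / real N" "real (g i) / real N - y i"] by simp
    qed
    moreover have "\<bar>k g\<bar> \<le> Max ((\<lambda>g. \<bar>k g\<bar>) ` G)"
      using \<open>finite G\<close> \<open>g \<in> G\<close> by (intro Max_ge) simp_all
    ultimately show "\<exists>k'. \<bar>k'\<bar> \<le> Max ((\<lambda>g. \<bar>k g\<bar>) ` G) \<and> (\<forall>i<D. nrm (of_int k' * a i - y i) < e)"
      by blast
  qed
qed

lemma uniformly_cont_bounded_times:
  assumes "e > 0"
  shows "\<exists>\<delta>>0. \<forall>k y z. \<bar>k\<bar> \<le> K \<longrightarrow> (\<forall>i<D. nrm (y i - z i) < \<delta>) \<longrightarrow> \<bar>\<psi> k y - \<psi> k z\<bar> < e"
proof -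
  obtain \<delta> where \<delta>: "\<And>k. \<delta> k > 0"
      "\<And>k y z. (\<forall>i<D. nrm (y i - z i) < \<delta> k) \<longrightarrow> \<bar>\<psi> k y - \<psi> k z\<bar> < e"
    using uniformly_cont[OF assms] by metis
  \<comment> \<open>The element 1 keeps the set nonempty when \<open>K\<close> is negative.\<close>
  let ?S = "insert 1 (\<delta> ` {- K..K})"
  have "Min ?S > 0" using \<delta>(1) by (subst Min_gr_iff) auto
  moreover have "\<bar>\<psi> k y - \<psi> k z\<bar> < e" if "\<bar>k\<bar> \<le> K" "\<forall>i<D. nrm (y i - z i) < Min ?S" for k y z
  proof -
    have "Min ?S \<le> \<delta> k" using that(1) by (intro Min_le insertI2 imageI) auto
    then have "\<forall>i<D. nrm (y i - z i) < \<delta> k" using that(2) less_le_trans by blast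
    then show ?thesis using \<delta>(2) by blast
  qed
  ultimately show ?thesis by blast
qed

text \<open>Since \<open>\<psi> n (z + k a) - \<psi> n z = \<psi> k (z + n a) - \<psi> k z\<close>, at a time \<open>n\<close> of close return the
  values of \<open>\<psi> n\<close> anywhere on the torus are almost attained in every ball.\<close>

lemma values_in_ball:
  assumes e: "e > 0" and \<eta>: "\<eta> > 0"
  shows "\<exists>\<delta>>0. \<forall>n. (\<forall>i<D. nrm (of_int n * a i) < \<delta>) \<longrightarrow>
    (\<forall>y0 z. \<exists>w. (\<forall>i<D. \<bar>w i - y0 i\<bar> < e) \<and> \<bar>\<psi> n w - \<psi> n z\<bar> < \<eta>)"
proof -
  obtain K where K: "\<And>y. \<exists>k::int. \<bar>k\<bar> \<le> K \<and> (\<forall>i<D. nrm (of_int k * a i - y i) < e)"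
    using syndetic[OF e] by blast
  obtain \<delta> where \<delta>: "\<delta> > 0"
      "\<And>k y z. \<bar>k\<bar> \<le> K \<Longrightarrow> (\<forall>i<D. nrm (y i - z i) < \<delta>) \<Longrightarrow> \<bar>\<psi> k y - \<psi> k z\<bar> < \<eta>"
    using uniformly_cont_bounded_times[OF \<eta>, of K] by blast
  have "\<exists>w. (\<forall>i<D. \<bar>w i - y0 i\<bar> < e) \<and> \<bar>\<psi> n w - \<psi> n z\<bar> < \<eta>"
    if n: "\<forall>i<D. nrm (of_int n * a i) < \<delta>" for n y0 z
  proof -
    obtain k :: int where k: "\<bar>k\<bar> \<le> K" "\<forall>i<D. nrm (of_int k * a i - (y0 i - z i)) < e"
      using K[of "\<lambda>i. y0 i - z i"] by blast
    have "\<forall>i. \<exists>m::int. i < D \<longrightarrow> \<bar>of_int k * a i - (y0 i - z i) - of_int m\<bar> < e"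
      using k(2) unfolding nrm_less_iff by blast
    then obtain m :: "nat \<Rightarrow> int" where m: "\<And>i. i < D \<Longrightarrow> \<bar>of_int k * a i - (y0 i - z i) - of_int (m i)\<bar> < e"
      by metis
    \<comment> \<open>Subtracting the integers \<open>m i\<close> turns closeness to
      \<open>y0\<close> modulo 1 into closeness in \<real>, as the intermediate value theorem
      requires.\<close>
    define w where "w i = z i + of_int k * a i - of_int (m i)" for i
    have "\<psi> n w = \<psi> n (\<lambda>i. z i + of_int k * a i)"
    proof (rule periodic)
      fix i
      show "nrm (w i - (z i + of_int k * a i)) = 0"
        using nrm_shift_int[of 0 "- m i"] by (simp add: w_def)
    qed
    moreover have "\<psi> n z + \<psi> k (\<lambda>i. z i + of_int n * a i) = \<psi> k z + \<psi> n (\<lambda>i. z i + of_int k * a i)"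
      using cocycle[of n k z] cocycle[of k n z] by (simp add: add.commute)
    moreover have "\<bar>\<psi> k (\<lambda>i. z i + of_int n * a i) - \<psi> k z\<bar> < \<eta>"
      by (rule \<delta>(2)[OF k(1)]) (use n in simp)
    moreover have "\<bar>w i - y0 i\<bar> < e" if "i < D" for i
      using m[OF that] by (simp add: w_def algebra_simps)
    ultimately show ?thesis by (intro exI[of _ w]) auto
  qed
  then show ?thesis using \<delta>(1) by blast
qed

text \<open>The box around \<open>y0\<close> is convex, so the segment from \<open>w\<close> to
  \<open>w'\<close> stays inside, and \<open>\<psi> n\<close> is continuous along it. Hence true
  distances of lifts here instead of \<open>nrm\<close>.\<close>

lemma intermediate_value:
  assumes "\<psi> n w \<le> t" "t \<le> \<psi> n w'"
    and "\<forall>i<D. \<bar>w i - y0 i\<bar> < e" "\<forall>i<D. \<bar>w' i - y0 i\<bar> < e"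
  shows "\<exists>y. (\<forall>i<D. \<bar>y i - y0 i\<bar> < e) \<and> \<psi> n y = t"
proof -
  define p where "p s = (\<lambda>i. w i + s * (w' i - w i))" for s :: real
  have "continuous_on {0..1} (\<lambda>s. \<psi> n (p s))"
    unfolding continuous_on_iff
  proof (intro ballI allI impI)
    fix s \<epsilon> :: real assume "\<epsilon> > 0"
    then obtain \<delta> where \<delta>: "\<delta> > 0" "\<And>y z. (\<forall>i<D. nrm (y i - z i) < \<delta>) \<Longrightarrow> \<bar>\<psi> n y - \<psi> n z\<bar> < \<epsilon>"
      using uniformly_cont by metis
    \<comment> \<open>The summand 1 keeps \<open>M\<close> positive when \<open>w\<close> and
      \<open>w'\<close> agree below \<open>D\<close>.\<close>
    define M where "M = 1 + (\<Sum>i<D. \<bar>w' i - w i\<bar>)"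
    have M: "M > 0" unfolding M_def by (intro add_pos_nonneg sum_nonneg) simp_all
    show "\<exists>d>0. \<forall>s'\<in>{0..1}. dist s' s < d \<longrightarrow> dist (\<psi> n (p s')) (\<psi> n (p s)) < \<epsilon>"
    proof (intro exI[of _ "\<delta> / M"] conjI ballI impI)
      show "\<delta> / M > 0" using M \<delta>(1) by simp
      fix s' assume s': "dist s' s < \<delta> / M"
      have "nrm (p s' i - p s i) < \<delta>" if "i < D" for i
      proof -
        have "\<bar>w' i - w i\<bar> \<le> (\<Sum>i<D. \<bar>w' i - w i\<bar>)"
          by (rule member_le_sum) (use that in auto)
        then have "\<bar>w' i - w i\<bar> \<le> M" by (simp add: M_def)
        have "p s' i - p s i = (s' - s) * (w' i - w i)" by (simp add: p_def algebra_simps)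
        then have "\<bar>p s' i - p s i\<bar> = \<bar>s' - s\<bar> * \<bar>w' i - w i\<bar>" by (simp add: abs_mult)
        also have "\<dots> \<le> \<bar>s' - s\<bar> * M" using \<open>\<bar>w' i - w i\<bar> \<le> M\<close> by (intro mult_left_mono) simp_all
        also have "\<dots> < \<delta>" using s' M by (simp add: dist_real_def field_simps)
        finally show ?thesis using nrm_le_abs[of "p s' i - p s i"] by linarith
      qed
      then show "dist (\<psi> n (p s')) (\<psi> n (p s)) < \<epsilon>"
        unfolding dist_real_def by (intro \<delta>(2)) blast
    qed
  qed
  moreover have "p 0 = w" "p 1 = w'" by (simp_all add: p_def)
  ultimately obtain s where s: "0 \<le> s" "s \<le> 1" "\<psi> n (p s) = t"
    using IVT'[of "\<lambda>s. \<psi> n (p s)" 0 t 1] assms(1,2) by auto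
  have "\<bar>p s i - y0 i\<bar> < e" if i: "i < D" for i
  proof -
    have "p s i \<in> {y0 i - e<..<y0 i + e}"
    proof (cases "w i \<le> w' i")
      case True
      have "s * (w' i - w i) \<le> 1 * (w' i - w i)" "0 \<le> s * (w' i - w i)"
        using True s by (intro mult_right_mono mult_nonneg_nonneg; simp)+
      then show ?thesis using assms(3,4) i unfolding p_def by (force simp: abs_less_iff)
    next
      case False
      have "s * (w i - w' i) \<le> 1 * (w i - w' i)" "0 \<le> s * (w i - w' i)"
        using False s by (intro mult_right_mono mult_nonneg_nonneg; simp)+
      moreover have "s * (w' i - w i) = - (s * (w i - w' i))" by (simp add: algebra_simps)
      ultimately show ?thesis using assms(3,4) i unfolding p_def by (force simp: abs_less_iff)
    qed
    then show ?thesis by auto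
  qed
  with s show ?thesis by blast
qed

text \<open>Syndeticity is applied to the target \<open>- (N + K) * a\<close>: the time
  \<open>k + N + K\<close> then returns close to 0, and it is at least \<open>N\<close> because |k|
  \<le> \<open>K\<close>.\<close>

lemma large_return:
  assumes "e > 0"
  shows "\<exists>n. (\<forall>i<D. nrm (of_int n * a i) < e) \<and> B \<le> \<psi> n (\<lambda>_. 0)"
proof -
  obtain K where K: "\<And>y. \<exists>k::int. \<bar>k\<bar> \<le> K \<and> (\<forall>i<D. nrm (of_int k * a i - y i) < e)"
    using syndetic[OF assms] by blast
  obtain N where N: "\<And>n. N \<le> \<bar>n\<bar> \<Longrightarrow> B \<le> \<psi> n (\<lambda>_. 0)" using proper by blast
  obtain k :: int where k: "\<bar>k\<bar> \<le> K" "\<forall>i<D. nrm (of_int k * a i - of_int (- (N + K)) * a i) < e"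
    using K[of "\<lambda>i. of_int (- (N + K)) * a i"] by blast
  have "of_int k * a i - of_int (- (N + K)) * a i = of_int (k + N + K) * a i" for i
    by (simp add: algebra_simps)
  with k(2) have "\<forall>i<D. nrm (of_int (k + N + K) * a i) < e" by simp
  moreover have "B \<le> \<psi> (k + N + K) (\<lambda>_. 0)" using k(1) by (intro N) linarith
  ultimately show ?thesis by blast
qed

text \<open>At a close return with value at least \<open>2 * t\<close> at the origin, both this
  value and 0 are approximated in the ball with error less than \<open>t\<close>. That gives points
  with values on either side of \<open>t\<close>.\<close>

lemma attain_pos_value:
  assumes e: "e > 0" and t: "t > 0"
  shows "\<exists>n y. (\<forall>i<D. nrm (of_int n * a i) < e) \<and> (\<forall>i<D. \<bar>y i - y0 i\<bar> < e) \<and> \<psi> n y = t"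
proof -
  obtain \<delta> where \<delta>: "\<delta> > 0" "\<And>n y0 z. \<forall>i<D. nrm (of_int n * a i) < \<delta> \<Longrightarrow>
      \<exists>w. (\<forall>i<D. \<bar>w i - y0 i\<bar> < e) \<and> \<bar>\<psi> n w - \<psi> n z\<bar> < t"
    using values_in_ball[OF e t] by metis
  obtain n where n: "\<forall>i<D. nrm (of_int n * a i) < min \<delta> e" "2 * t \<le> \<psi> n (\<lambda>_. 0)"
    using large_return[of "min \<delta> e" "2 * t"] e \<delta>(1) by auto
  have n\<delta>: "\<forall>i<D. nrm (of_int n * a i) < \<delta>" using n(1) by simp
  obtain z where z: "\<psi> n z = 0" using has_zero by blast
  obtain w where w: "\<forall>i<D. \<bar>w i - y0 i\<bar> < e" "\<bar>\<psi> n w - \<psi> n z\<bar> < t"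
    using \<delta>(2)[OF n\<delta>, of y0 z] by blast
  obtain w' where w': "\<forall>i<D. \<bar>w' i - y0 i\<bar> < e" "\<bar>\<psi> n w' - \<psi> n (\<lambda>_. 0)\<bar> < t"
    using \<delta>(2)[OF n\<delta>, of y0 "\<lambda>_. 0"] by blast
  obtain y where "\<forall>i<D. \<bar>y i - y0 i\<bar> < e" "\<psi> n y = t"
  proof -
    have "\<psi> n w \<le> t" using w(2) z by linarith
    moreover have "t \<le> \<psi> n w'" using w'(2) n(2) by linarith
    ultimately show thesis using intermediate_value[OF _ _ w(1) w'(1)] that by blast
  qed
  moreover have "\<forall>i<D. nrm (of_int n * a i) < e" using n(1) by simp
  ultimately show ?thesis by blast
qed

lemma \<psi>_0: "\<psi> 0 y = 0"
  using cocycle[of 0 0 y] by simp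

text \<open>Negative values come from reversing time: \<open>\<psi> (- n)\<close> at
  \<open>y + n a\<close> is \<open>- \<psi> n y\<close>. Half of \<open>e\<close> is reserved for
  the move from \<open>y\<close> to \<open>y + n a\<close>.\<close>

lemma attain_value:
  assumes e: "e > 0" and t: "t \<noteq> 0"
  shows "\<exists>n y. (\<forall>i<D. nrm (of_int n * a i) < e) \<and> (\<forall>i<D. \<bar>y i - y0 i\<bar> < e) \<and> \<psi> n y = t"
proof (cases "t > 0")
  case True
  then show ?thesis using attain_pos_value[OF e] by blast
next
  case False
  with t have "- t > 0" by simp
  from e have e2: "e / 2 > 0" by simp
  obtain n y where n: "\<forall>i<D. nrm (of_int n * a i) < e / 2" and y: "\<forall>i<D. \<bar>y i - y0 i\<bar> < e / 2" "\<psi> n y = - t"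
    using attain_pos_value[OF e2 \<open>- t > 0\<close>, of y0] by blast
  have "\<forall>i. \<exists>m::int. i < D \<longrightarrow> \<bar>of_int n * a i - of_int m\<bar> < e / 2"
    using n unfolding nrm_less_iff by blast
  then obtain m :: "nat \<Rightarrow> int" where m: "\<And>i. i < D \<Longrightarrow> \<bar>of_int n * a i - of_int (m i)\<bar> < e / 2"
    by metis
  define y' where "y' i = y i + of_int n * a i - of_int (m i)" for i
  have "\<psi> (- n) y' = \<psi> (- n) (\<lambda>i. y i + of_int n * a i)"
  proof (rule periodic)
    fix i
    show "nrm (y' i - (y i + of_int n * a i)) = 0"
      using nrm_shift_int[of 0 "- m i"] by (simp add: y'_def)
  qed
  also have "\<dots> = t"
    using cocycle[of n "- n" y] y(2) \<psi>_0 by simp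
  finally have "\<psi> (- n) y' = t" .
  moreover have "\<forall>i<D. nrm (of_int (- n) * a i) < e"
  proof (intro allI impI)
    fix i assume "i < D"
    then have "nrm (of_int n * a i) < e / 2" using n by blast
    then show "nrm (of_int (- n) * a i) < e" using nrm_minus[of "of_int n * a i"] e by simp
  qed
  moreover have "\<forall>i<D. \<bar>y' i - y0 i\<bar> < e"
  proof (intro allI impI)
    fix i assume i: "i < D"
    have "y' i - y0 i = (y i - y0 i) + (of_int n * a i - of_int (m i))" by (simp add: y'_def)
    then show "\<bar>y' i - y0 i\<bar> < e" using m[OF i] y(1) i by (smt (verit) field_sum_of_halves)
  qed
  ultimately show ?thesis by blast
qed

text \<open>A fixed time \<open>k\<close> carries \<open>y0\<close> close to \<open>y1\<close> and
  changes the height by about \<open>\<psi> k y0\<close>. A close return \<open>n\<close> beforehand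
  hardly moves the base point and supplies the missing height
  \<open>t - \<psi> k y0\<close>.\<close>

lemma topologically_transitive:
  assumes e: "e > 0"
  shows "\<exists>n y. (\<forall>i<D. \<bar>y i - y0 i\<bar> < e) \<and> (\<forall>i<D. nrm (y i + of_int n * a i - y1 i) < e) \<and> \<bar>\<psi> n y - t\<bar> < e"
proof -
  have e2: "e / 2 > 0" using e by simp
  obtain k :: int where k: "\<forall>i<D. nrm (of_int k * a i - (y1 i - y0 i)) < e / 2"
    using kronecker[OF e2, of "\<lambda>i. y1 i - y0 i"] by blast
  obtain \<delta>' where \<delta>': "\<delta>' > 0" "\<And>y z. (\<forall>i<D. nrm (y i - z i) < \<delta>') \<Longrightarrow> \<bar>\<psi> k y - \<psi> k z\<bar> < e / 2"
    using uniformly_cont[OF e2, of k] by blast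
  \<comment> \<open>Both the start and the return contribute an error \<delta>, so
    \<open>y + n a\<close> is within \<open>2 * \<delta>\<close> of \<open>y0\<close>.\<close>
  define \<delta> where "\<delta> = min (\<delta>' / 2) (e / 4)"
  have \<delta>: "\<delta> > 0" "2 * \<delta> \<le> \<delta>'" "2 * \<delta> \<le> e / 2" using \<delta>'(1) e by (auto simp: \<delta>_def)
  \<comment> \<open>\<open>attain_value\<close> excludes the height 0, which is therefore replaced
    by a small one.\<close>
  define t' where "t' = (if t = \<psi> k y0 then e / 4 else t - \<psi> k y0)"
  have t': "t' \<noteq> 0" "\<bar>t' - (t - \<psi> k y0)\<bar> < e / 2" using e by (auto simp: t'_def)
  obtain n y where n: "\<forall>i<D. nrm (of_int n * a i) < \<delta>" and y: "\<forall>i<D. \<bar>y i - y0 i\<bar> < \<delta>" "\<psi> n y = t'"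
    using attain_value[OF \<delta>(1) t'(1), of y0] by blast
  have near: "nrm (y i + of_int n * a i - y0 i) < 2 * \<delta>" if i: "i < D" for i
  proof -
    have "nrm (y i - y0 i) < \<delta>" using nrm_le_abs[of "y i - y0 i"] y(1) i by (meson le_less_trans)
    moreover have "nrm (of_int n * a i) < \<delta>" using n i by blast
    ultimately show ?thesis
      using nrm_add[of "y i - y0 i" "of_int n * a i"] by (simp add: algebra_simps)
  qed
  have "\<bar>\<psi> k (\<lambda>i. y i + of_int n * a i) - \<psi> k y0\<bar> < e / 2"
  proof (rule \<delta>'(2), intro allI impI)
    fix i assume "i < D"
    from near[OF this] \<delta>(2) show "nrm (y i + of_int n * a i - y0 i) < \<delta>'" by linarith
  qed
  then have 1: "\<bar>\<psi> (n + k) y - t\<bar> < e"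
    using cocycle[of n k y] y(2) t'(2) by linarith
  have 2: "nrm (y i + of_int (n + k) * a i - y1 i) < e" if i: "i < D" for i
  proof -
    have eq: "y i + of_int (n + k) * a i - y1 i =
        (y i + of_int n * a i - y0 i) + (of_int k * a i - (y1 i - y0 i))"
      by (simp add: algebra_simps)
    have "nrm (of_int k * a i - (y1 i - y0 i)) < e / 2" using k i by blast
    then show ?thesis
      unfolding eq using near[OF i] \<delta>(3) nrm_add[of "y i + of_int n * a i - y0 i" "of_int k * a i - (y1 i - y0 i)"]
      by linarith
  qed
  have 3: "\<forall>i<D. \<bar>y i - y0 i\<bar> < e"
  proof (intro allI impI)
    fix i assume "i < D"
    then have "\<bar>y i - y0 i\<bar> < \<delta>" using y(1) by blast
    then show "\<bar>y i - y0 i\<bar> < e" using \<delta> by linarith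
  qed
  show ?thesis using 1 2 3 by blast
qed

section \<open>A dense orbit from Baire's theorem\<close>

lemma continuous_at_\<psi>: "isCont (\<psi> n) (y :: nat \<Rightarrow> real)"
  unfolding isCont_def
proof (rule tendstoI)
  fix e :: real assume "e > 0"
  then obtain \<delta> where \<delta>: "\<delta> > 0" "\<And>z z'. (\<forall>i<D. nrm (z i - z' i) < \<delta>) \<Longrightarrow> \<bar>\<psi> n z - \<psi> n z'\<bar> < e"
    using uniformly_cont by metis
  have "\<forall>\<^sub>F z in at y. \<bar>z i - y i\<bar> < \<delta>" for i
  proof -
    have "continuous_on UNIV (\<lambda>z :: nat \<Rightarrow> real. z i)"
      by (rule continuous_on_product_coordinates)
    then have "((\<lambda>z. z i) \<longlongrightarrow> y i) (at y)"
      by (simp add: continuous_on_def)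
    from tendstoD[OF this \<delta>(1)] show ?thesis by (simp add: dist_real_def)
  qed
  then have "\<forall>\<^sub>F z in at y. \<forall>i\<in>{..<D}. \<bar>z i - y i\<bar> < \<delta>"
    by (intro eventually_ball_finite) auto
  then show "\<forall>\<^sub>F z in at y. dist (\<psi> n z) (\<psi> n y) < e"
  proof (rule eventually_mono)
    fix z assume z: "\<forall>i\<in>{..<D}. \<bar>z i - y i\<bar> < \<delta>"
    show "dist (\<psi> n z) (\<psi> n y) < e"
      unfolding dist_real_def
    proof (rule \<delta>(2), intro allI impI)
      fix i assume "i < D"
      with z have "\<bar>z i - y i\<bar> < \<delta>" by simp
      then show "nrm (z i - y i) < \<delta>" using nrm_le_abs le_less_trans by blast
    qed
  qed
qed

text \<open>The starting points whose orbit at height 0 comes \<open>e\<close>-close to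
  \<open>(w, t)\<close>. They are taken in the space of all real sequences, a complete metric space
  to which Baire's theorem applies.\<close>

definition visits :: "(nat \<Rightarrow> real) \<Rightarrow> real \<Rightarrow> real \<Rightarrow> (nat \<Rightarrow> real) set" where
  "visits w t e = {y. \<exists>n. (\<forall>i<D. nrm (y i + of_int n * a i - w i) < e) \<and> \<bar>\<psi> n y - t\<bar> < e}"

lemma open_visits: "open (visits w t e)"
proof -
  have 1: "open {y :: nat \<Rightarrow> real. nrm (y i + of_int n * a i - w i) < e}" for i n
    by (intro open_Collect_less continuous_intros continuous_on_product_coordinates)
  have 2: "open {y. \<bar>\<psi> n y - t\<bar> < e}" for n
    by (intro open_Collect_less continuous_intros continuous_at_imp_continuous_on ballI continuous_at_\<psi>)
  have "visits w t e =
      (\<Union>n. (\<Inter>i\<in>{..<D}. {y. nrm (y i + of_int n * a i - w i) < e}) \<inter> {y. \<bar>\<psi> n y - t\<bar> < e})"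
    by (auto simp: visits_def)
  also have "open \<dots>"
    by (intro open_UN open_Int open_INT ballI 1 2) simp
  finally show ?thesis .
qed

lemma dense_visits:
  assumes "e > 0"
  shows "closure (visits w t e) = UNIV"
proof -
  have "U \<inter> visits w t e \<noteq> {}" if U: "open U" "y0 \<in> U" for U and y0 :: "nat \<Rightarrow> real"
  proof -
    obtain V where V: "\<And>i. open (V i)" "y0 \<in> Pi\<^sub>E UNIV V" "Pi\<^sub>E UNIV V \<subseteq> U"
      using U unfolding open_fun_def openin_product_topology_alt by (metis UNIV_I open_openin)
    have "\<forall>i. \<exists>r>0. \<forall>s. \<bar>s - y0 i\<bar> < r \<longrightarrow> s \<in> V i"
    proof
      fix i
      have "y0 i \<in> V i" using V(2) by auto
      with V(1)[of i] show "\<exists>r>0. \<forall>s. \<bar>s - y0 i\<bar> < r \<longrightarrow> s \<in> V i"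
        unfolding open_dist dist_real_def by blast
    qed
    then obtain r where r: "\<And>i. r i > 0" "\<And>i s. \<bar>s - y0 i\<bar> < r i \<Longrightarrow> s \<in> V i"
      by metis
    define \<delta> where "\<delta> = Min (insert e (r ` {..<D}))"
    have \<delta>: "\<delta> > 0" "\<delta> \<le> e" "\<And>i. i < D \<Longrightarrow> \<delta> \<le> r i"
      unfolding \<delta>_def using assms r(1) by (auto simp: Min_gr_iff intro: Min_le)
    obtain n y where y: "\<forall>i<D. \<bar>y i - y0 i\<bar> < \<delta>" "\<forall>i<D. nrm (y i + of_int n * a i - w i) < \<delta>"
        "\<bar>\<psi> n y - t\<bar> < \<delta>"
      using topologically_transitive[OF \<delta>(1)] by blast
    \<comment> \<open>A basic open set may also restrict coordinates from \<open>D\<close> on. There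
      \<open>y'\<close> copies \<open>y0\<close>, and \<open>\<psi> n\<close> does not see the
      change.\<close>
    define y' where "y' i = (if i < D then y i else y0 i)" for i
    have "\<psi> n y' = \<psi> n y"
      by (rule periodic) (simp add: y'_def)
    moreover have "nrm (y' i + of_int n * a i - w i) < e" if "i < D" for i
    proof -
      have "nrm (y i + of_int n * a i - w i) < \<delta>" using y(2) that by blast
      with that \<delta>(2) show ?thesis by (simp add: y'_def)
    qed
    ultimately have "y' \<in> visits w t e"
      using y(3) \<delta>(2) by (auto simp: visits_def intro!: exI[of _ n])
    moreover have "y' i \<in> V i" for i
    proof (cases "i < D")
      case True
      then have "\<bar>y i - y0 i\<bar> < r i" using y(1) \<delta>(3)[OF True] by force
      with r(2) True show ?thesis by (simp add: y'_def)
    next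
      case False
      then show ?thesis using V(2) by (auto simp: y'_def)
    qed
    then have "y' \<in> U" using V(3) by auto
    ultimately show ?thesis by blast
  qed
  then show ?thesis
    by (auto simp: closure_iff_nhds_not_empty) blast
qed

text \<open>Countably many targets with rational coordinates and radii \<open>1 / Suc N\<close>
  suffice; a point common to their dense open sets of visitors has a dense orbit.\<close>

lemma ex_dense_orbit:
  "\<exists>y. \<forall>w t e. e > 0 \<longrightarrow> (\<exists>n. (\<forall>i<D. nrm (y i + of_int n * a i - w i) < e) \<and> \<bar>\<psi> n y - t\<bar> < e)"
proof -
  \<comment> \<open>Lists instead of functions keep the index set countable. For a list shorter than
    \<open>D\<close> the entries past its end are arbitrary targets and do no harm.\<close>
  define G where "G = (\<lambda>(l :: rat list, q :: rat, N :: nat).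
    visits (\<lambda>i. of_rat (l ! i)) (of_rat q) (1 / real (Suc N)))"
  have "euclidean closure_of (\<Inter>(range G)) = UNIV"
  proof -
    have "open T \<and> closure T = UNIV" if "T \<in> range G" for T
      using that by (auto simp: G_def open_visits dense_visits)
    then show ?thesis
      using Met_TC.metric_Baire_category[of "range G"] by (simp add: complete_UNIV)
  qed
  then have "\<Inter>(range G) \<noteq> {}" by force
  then obtain y where y: "\<And>l q N. y \<in> visits (\<lambda>i. of_rat (l ! i)) (of_rat q) (1 / real (Suc N))"
    by (force simp: G_def)
  have "\<exists>n. (\<forall>i<D. nrm (y i + of_int n * a i - w i) < e) \<and> \<bar>\<psi> n y - t\<bar> < e"
    if e: "e > 0" for w t e
  proof -
    obtain N where N: "1 / real (Suc N) < e / 2"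
      using nat_approx_posE[of "e / 2"] e by auto
    have rat: "\<exists>q. \<bar>of_rat q - s\<bar> < e / 2" for s :: real
    proof -
      obtain q where "s - e / 2 < of_rat q" "of_rat q < s + e / 2"
        using of_rat_dense[of "s - e / 2" "s + e / 2"] e by auto
      then show ?thesis by (intro exI[of _ q]) linarith
    qed
    obtain q where q: "\<bar>of_rat q - t\<bar> < e / 2" using rat by blast
    have "\<forall>i. \<exists>q. \<bar>of_rat q - w i\<bar> < e / 2" using rat by blast
    then obtain f where f: "\<forall>i. \<bar>of_rat (f i) - w i\<bar> < e / 2" by (rule choice[THEN exE])
    obtain n where n: "\<forall>i<D. nrm (y i + of_int n * a i - of_rat (map f [0..<D] ! i)) < 1 / real (Suc N)"
        "\<bar>\<psi> n y - of_rat q\<bar> < 1 / real (Suc N)"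
      using y[of "map f [0..<D]" q N] unfolding visits_def by blast
    have "nrm (y i + of_int n * a i - w i) < e" if i: "i < D" for i
    proof -
      have "nrm (y i + of_int n * a i - of_rat (f i)) < 1 / real (Suc N)" using n(1) i by auto
      moreover have "nrm (of_rat (f i) - w i) < e / 2" using nrm_le_abs f[rule_format] by (rule le_less_trans)
      moreover have eq: "y i + of_int n * a i - w i = (y i + of_int n * a i - of_rat (f i)) + (of_rat (f i) - w i)"
        by simp
      ultimately show ?thesis
        unfolding eq using nrm_add[of "y i + of_int n * a i - of_rat (f i)" "of_rat (f i) - w i"] N by linarith
    qed
    moreover have "\<bar>\<psi> n y - t\<bar> < e" using n(2) N q by linarith
    ultimately show ?thesis by blast
  qed
  then show ?thesis by blast
qed

end

section \<open>Lacunary frequencies\<close>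

text \<open>Multiplication by \<open>2 ^ M\<close> makes the digits up to place \<open>e k\<close>
  integral. The remaining tail lies between its first term and twice that term, by comparison with a
  geometric series.\<close>

lemma lacunary_dyadic_expansion:
  assumes e: "strict_mono (e :: nat \<Rightarrow> nat)" and M: "e k \<le> M"
  shows "\<exists>(z::int) \<tau>. 2 ^ M * (\<Sum>l. (1 / 2 :: real) ^ e l) = of_int z + \<tau> \<and>
    2 ^ M / 2 ^ e (Suc k) \<le> \<tau> \<and> \<tau> \<le> 2 * (2 ^ M / 2 ^ e (Suc k))"
proof -
  have e_add: "e n + l \<le> e (l + n)" for n l
  proof (induction l)
    case (Suc l)
    have "e (l + n) < e (Suc l + n)" using e by (simp add: strict_mono_def)
    with Suc show ?case by simp
  qed simp
  have geo: "summable (\<lambda>l. (1 / 2 :: real) ^ l)" by (rule summable_geometric) simp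
  have term_le: "(1 / 2 :: real) ^ e (l + n) \<le> (1 / 2) ^ e n * (1 / 2) ^ l" for n l
    using power_decreasing[OF e_add[of n l], of "1 / 2 :: real"] by (simp add: power_add)
  have sum: "summable (\<lambda>l. (1 / 2 :: real) ^ e (l + n))" for n
    by (rule summable_comparison_test'[OF summable_mult[OF geo]]) (use term_le in simp)
  define T where "T = (\<Sum>l. (1 / 2 :: real) ^ e (l + Suc k))"
  have split: "(\<Sum>l. (1 / 2 :: real) ^ e l) = T + (\<Sum>l<Suc k. (1 / 2) ^ e l)"
    unfolding T_def using sum[of 0] by (intro suminf_split_initial_segment) simp
  have "2 ^ M * (1 / 2 :: real) ^ e l = of_int (2 ^ (M - e l))" if "l < Suc k" for l
  proof -
    have "e l \<le> e k" using e that by (simp add: strict_mono_less_eq)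
    then have "(2::real) ^ M = 2 ^ (M - e l) * 2 ^ e l" using M by (simp flip: power_add)
    then show ?thesis by (simp add: power_one_over)
  qed
  then have head: "2 ^ M * (\<Sum>l<Suc k. (1 / 2 :: real) ^ e l) = of_int (\<Sum>l<Suc k. 2 ^ (M - e l))"
    unfolding sum_distrib_left of_int_sum by (intro sum.cong) simp_all
  have "(1 / 2 :: real) ^ e (Suc k) = (\<Sum>l\<in>{0}. (1 / 2) ^ e (l + Suc k))" by simp
  also have "\<dots> \<le> T"
    unfolding T_def by (rule sum_le_suminf[OF sum]) simp_all
  finally have lower: "1 / 2 ^ e (Suc k) \<le> T" by (simp add: power_one_over)
  have "T \<le> (\<Sum>l. (1 / 2) ^ e (Suc k) * (1 / 2) ^ l)"
    unfolding T_def by (intro suminf_le allI term_le sum summable_mult geo)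
  also have "\<dots> = (1 / 2) ^ e (Suc k) * 2"
    using suminf_mult[OF geo, of "(1 / 2) ^ e (Suc k)"] suminf_geometric[of "1 / 2 :: real"] by simp
  finally have upper: "T \<le> 2 * (1 / 2 ^ e (Suc k))" by (simp add: power_one_over)
  have "2 ^ M * (\<Sum>l. (1 / 2 :: real) ^ e l) = of_int (\<Sum>l<Suc k. 2 ^ (M - e l)) + 2 ^ M * T"
    by (simp only: split distrib_left head add.commute)
  moreover have "2 ^ M / 2 ^ e (Suc k) \<le> 2 ^ M * T"
    using mult_left_mono[OF lower, of "2 ^ M"] by simp
  moreover have "2 ^ M * T \<le> 2 * (2 ^ M / 2 ^ e (Suc k))"
    using mult_left_mono[OF upper, of "2 ^ M"] by (simp add: mult_ac)
  ultimately show ?thesis by blast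
qed

text \<open>The shift by 2 skips the repeated value 1 of \<open>fib\<close>, which makes the
  sequence strictly increasing.\<close>

definition freq_exp :: "nat \<Rightarrow> nat"
  where "freq_exp j = fib (j + 2)"

lemma freq_exp_Suc: "freq_exp (Suc j) = freq_exp j + fib (Suc j)"
  by (simp add: freq_exp_def)

lemma fib_Suc_ge: "j \<le> fib (Suc j)"
proof (induction j rule: fib.induct)
  case (3 n)
  have "fib (Suc n) \<ge> 1" using fib_neq_0_nat[of "Suc n"] by (simp add: Suc_leI)
  with 3 show ?case by simp
qed simp_all

lemma freq_exp_ge: "j \<le> freq_exp j"
  using fib_Suc_ge[of "Suc j"] by (simp add: freq_exp_def)

lemma strict_mono_freq_exp: "strict_mono freq_exp"
  unfolding strict_mono_Suc_iff using fib_neq_0_nat[of "Suc _"] by (simp add: freq_exp_Suc)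

lemma freq_exp_add_ge: "2 ^ p * freq_exp j \<le> freq_exp (j + 2 * p)"
proof (induction p)
  case (Suc p)
  have "2 * freq_exp n \<le> freq_exp (n + 2)" for n
    by (simp add: freq_exp_def numeral_eq_Suc)
  from this[of "j + 2 * p"] Suc show ?case by simp
qed simp

text \<open>In powers of 2, with q = \<open>2 ^ freq_exp (Suc j)\<close>: period (j+1) times q^r is
  at most (period j)^2 / 4^(j+1). Doubling the exponent at \<open>j + d\<close> overshoots the one
  at \<open>Suc j + d\<close> by \<open>freq_exp (Suc j + 2 * (r + 2))\<close>, which is large
  enough to pay for the remaining terms.\<close>

lemma freq_exp_gap:
  assumes "d = 2 * r + 7"
  shows "freq_exp (Suc j + d) + r * freq_exp (Suc j) + 2 * freq_exp j + 2 * Suc j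
    \<le> freq_exp (Suc j) + 2 * freq_exp (j + d)"
proof -
  have p: "r + 4 \<le> 2 ^ (r + 2)" by (induction r) simp_all
  have eq: "2 * freq_exp (n + 2) = freq_exp (n + 3) + freq_exp n" for n
    by (simp add: freq_exp_def numeral_eq_Suc)
  have "(r + 4) * freq_exp (Suc j) \<le> 2 ^ (r + 2) * freq_exp (Suc j)" using p by simp
  also have "\<dots> \<le> freq_exp (Suc j + 2 * (r + 2))" by (rule freq_exp_add_ge)
  finally have "(r + 4) * freq_exp (Suc j) \<le> freq_exp (Suc j + 2 * (r + 2))" .
  moreover have "2 * freq_exp (j + d) = freq_exp (Suc j + d) + freq_exp (Suc j + 2 * (r + 2))"
    using eq[of "Suc j + 2 * (r + 2)"] assms by (simp add: numeral_eq_Suc)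
  moreover have "freq_exp j \<le> freq_exp (Suc j)" by (simp add: freq_exp_Suc)
  moreover have "Suc j \<le> freq_exp (Suc j)" by (rule freq_exp_ge)
  ultimately show ?thesis by (simp add: algebra_simps)
qed

section \<open>The rotation vector, the weights and the growth of the Birkhoff sums at 0\<close>

locale lacunary_frequencies =
  fixes r d :: nat
  assumes d: "d = 2 * r + 7"
begin

definition alpha :: "nat \<Rightarrow> real"
  where "alpha i = (\<Sum>k. (1 / 2) ^ freq_exp (i + d * k))"

text \<open>Up to a factor between 1 and 2, the reciprocal of the amount by which
  \<open>2 ^ freq_exp j * alpha i\<close>, for \<open>i = j mod d\<close>, exceeds an
  integer.\<close>

definition period :: "nat \<Rightarrow> real"
  where "period j = 2 ^ freq_exp (j + d) / 2 ^ freq_exp j"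

text \<open>Fitted to \<open>term_lower_bound\<close>: at the start of the \<open>j\<close>-th
  window 1 - cos is at least 2 (period (j-1) / (8 period j))^2, which the weight turns into
  \<open>j\<close>. The factor \<open>real j\<close> vanishes at 0, where \<open>j - 1\<close> is
  truncated.\<close>

definition weight :: "nat \<Rightarrow> real"
  where "weight j = 32 * real j * (period j / period (j - 1))\<^sup>2"

lemma d_pos: "d > 0" by (simp add: d)

lemma period_pos: "period j > 0"
  by (simp add: period_def)

lemma weight_nonneg: "weight j \<ge> 0"
  by (simp add: weight_def)

lemma alpha_expansion:
  assumes "freq_exp (i + d * k) \<le> M"
  shows "\<exists>(z::int) \<tau>. 2 ^ M * alpha i = of_int z + \<tau> \<and>
    2 ^ M / 2 ^ freq_exp (i + d * Suc k) \<le> \<tau> \<and> \<tau> \<le> 2 * (2 ^ M / 2 ^ freq_exp (i + d * Suc k))"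
proof -
  have "strict_mono (\<lambda>k. freq_exp (i + d * k))"
    using strict_mono_freq_exp d_pos by (simp add: strict_mono_def)
  from lacunary_dyadic_expansion[OF this assms] show ?thesis by (simp add: alpha_def)
qed

lemma alpha_phase:
  "\<exists>(z::int) \<theta>. real (2 ^ freq_exp (i + d * k)) * alpha i = of_int z + \<theta> \<and>
    1 / period (i + d * k) \<le> \<theta> \<and> \<theta> \<le> 2 / period (i + d * k)"
  using alpha_expansion[of i k "freq_exp (i + d * k)"] by (simp add: period_def algebra_simps)

text \<open>The sine is at most \<open>pi * (2 / period j)\<close>. With the weight this gives 64 pi
  j times period j q^r / (period (j-1))^2, a quotient that \<open>freq_exp_gap\<close> bounds by
  4^(-j); finally j \<le> 2^j and k \<le> j. For \<open>j = 0\<close> the weight is 0.\<close>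

lemma admissible_alpha:
  "admissible r (\<lambda>k. weight (i + d * k)) (\<lambda>k. 2 ^ freq_exp (i + d * k)) (alpha i)"
  unfolding admissible_def
proof (intro conjI allI)
  show "summable (\<lambda>k. weight (i + d * k) * real (2 ^ freq_exp (i + d * k)) ^ r *
      \<bar>sin (pi * real (2 ^ freq_exp (i + d * k)) * alpha i)\<bar>)"
  proof (rule summable_comparison_test')
    show "summable (\<lambda>k. 64 * pi * (1 / 2) ^ k)"
      by (intro summable_mult summable_geometric) simp
    fix k :: nat
    define j where "j = i + d * k"
    obtain z :: int and \<theta> where z: "real (2 ^ freq_exp j) * alpha i = of_int z + \<theta>"
        and \<theta>: "1 / period j \<le> \<theta>" "\<theta> \<le> 2 / period j"
      using alpha_phase[of i k] unfolding j_def by blast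
    have \<theta>0: "\<theta> \<ge> 0" using \<theta>(1) period_pos[of j] by (meson less_imp_le order_trans zero_le_divide_1_iff)
    have "pi * real (2 ^ freq_exp j) * alpha i = pi * \<theta> + pi * of_int z"
      using z by (simp add: mult.assoc distrib_left)
    then have "\<bar>sin (pi * real (2 ^ freq_exp j) * alpha i)\<bar> = \<bar>sin (pi * \<theta>)\<bar>"
      by (simp add: sin_add abs_mult cos_npi_int)
    also have "\<dots> \<le> pi * (2 / period j)"
      using abs_sin_x_le_abs_x[of "pi * \<theta>"] \<theta>(2) \<theta>0 mult_left_mono[OF \<theta>(2), of pi] by simp
    finally have sin_le: "\<bar>sin (pi * real (2 ^ freq_exp j) * alpha i)\<bar> \<le> pi * (2 / period j)" .
    have wq: "0 \<le> weight j * real (2 ^ freq_exp j) ^ r" by (simp add: weight_nonneg)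
    have "weight j * real (2 ^ freq_exp j) ^ r * (pi * (2 / period j)) \<le> 64 * pi * (1 / 2) ^ k"
    proof (cases j)
      case 0
      then show ?thesis by (simp add: weight_def)
    next
      case (Suc l)
      have "2 ^ (freq_exp (Suc l + d) + r * freq_exp (Suc l) + 2 * freq_exp l + 2 * Suc l) \<le>
          (2::real) ^ (freq_exp (Suc l) + 2 * freq_exp (l + d))"
        by (intro power_increasing freq_exp_gap[OF d]) simp
      then have "period j * real (2 ^ freq_exp j) ^ r / (period l)\<^sup>2 \<le> 1 / 2 ^ (2 * j)"
        unfolding Suc period_def
        by (simp add: power_add power_mult divide_simps power_divide mult_ac flip: power_mult)
      moreover have "weight j * real (2 ^ freq_exp j) ^ r * (pi * (2 / period j)) =
          64 * pi * (real j * (period j * real (2 ^ freq_exp j) ^ r / (period l)\<^sup>2))"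
        using period_pos[of j] Suc by (simp add: weight_def power2_eq_square)
      moreover have "real j * (1 / 2 ^ (2 * j)) \<le> (1 / 2) ^ k"
      proof -
        have "real j \<le> 2 ^ j" using of_nat_less_two_power[of j] by (simp add: less_imp_le)
        then have "real j * (1 / 2 ^ (2 * j)) \<le> 2 ^ j * (1 / 2 ^ (2 * j))"
          by (intro mult_right_mono) simp_all
        also have "\<dots> = (1 / 2) ^ j" by (simp add: power_one_over mult_2 power_add)
        also have "\<dots> \<le> (1 / 2) ^ k"
        proof (rule power_decreasing)
          have "k * 1 \<le> k * d" using d_pos by (intro mult_le_mono2) simp
          then show "k \<le> j" by (simp add: j_def mult.commute trans_le_add2)
        qed simp_all
        finally show ?thesis .
      qed
      moreover have "real j * (period j * real (2 ^ freq_exp j) ^ r / (period l)\<^sup>2) \<le> real j * (1 / 2 ^ (2 * j))"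
        using calculation(1) by (rule mult_left_mono) simp
      ultimately have "real j * (period j * real (2 ^ freq_exp j) ^ r / (period l)\<^sup>2) \<le> (1 / 2) ^ k"
          and eq: "weight j * real (2 ^ freq_exp j) ^ r * (pi * (2 / period j)) =
            64 * pi * (real j * (period j * real (2 ^ freq_exp j) ^ r / (period l)\<^sup>2))"
        by linarith+
      then show ?thesis unfolding eq by (intro mult_left_mono) simp_all
    qed
    with mult_left_mono[OF sin_le wq]
    have "weight j * real (2 ^ freq_exp j) ^ r * \<bar>sin (pi * real (2 ^ freq_exp j) * alpha i)\<bar> \<le> 64 * pi * (1 / 2) ^ k"
      by (rule order_trans)
    then show "norm (weight (i + d * k) * real (2 ^ freq_exp (i + d * k)) ^ r *
        \<bar>sin (pi * real (2 ^ freq_exp (i + d * k)) * alpha i)\<bar>) \<le> 64 * pi * (1 / 2) ^ k"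
      unfolding j_def[symmetric] real_norm_def
      by (subst abs_of_nonneg[OF mult_nonneg_nonneg[OF wq abs_ge_zero]])
  qed
qed (simp_all add: weight_nonneg)

lemma sin_ge_half:
  fixes y :: real
  assumes "0 \<le> y" "y \<le> pi / 3"
  shows "y / 2 \<le> sin y"
proof (cases "y = 0")
  case False
  with assms have "0 < y" by simp
  then obtain z where z: "0 < z" "z < y" "sin y - sin 0 = (y - 0) * cos z"
    using MVT2[of 0 y sin cos] by auto
  have "cos (pi / 3) \<le> cos z"
    using z assms by (intro cos_monotone_0_pi_le) simp_all
  then have "y * (1 / 2) \<le> y * cos z" using assms(1) by (intro mult_left_mono) (simp_all add: cos_60)
  with z show ?thesis by simp
qed simp

text \<open>At the point 0 the unshifted cosines equal 1, so no term of the series is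
  negative.\<close>

lemma single_term_le:
  fixes n :: int
  shows "weight (i + d * k) * (1 - cos (2 * pi * real (2 ^ freq_exp (i + d * k)) * (of_int n * alpha i)))
    \<le> coboundary_sum (\<lambda>k. weight (i + d * k)) (\<lambda>k. 2 ^ freq_exp (i + d * k)) (of_int n * alpha i) 0"
proof -
  let ?f = "\<lambda>k. weight (i + d * k) * (cos (2 * pi * real (2 ^ freq_exp (i + d * k)) * 0) -
      cos (2 * pi * real (2 ^ freq_exp (i + d * k)) * (0 + of_int n * alpha i)))"
  have s: "summable ?f"
    by (rule coboundary_term_summable[OF admissible_int_mult[OF admissible_alpha]])
  have "sum ?f {k} \<le> suminf ?f"
    by (rule sum_le_suminf[OF s]) (auto intro!: mult_nonneg_nonneg weight_nonneg)
  then show ?thesis by (simp add: coboundary_sum_def)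
qed

text \<open>The divisor 8 keeps x = |n| \<theta> at most 1/4: the phase has not turned round yet,
  and sin (pi x) \<ge> pi x / 2 \<ge> x. The lower end of the window bounds x from below, and 1 -
  cos (2 pi x) = 2 sin^2 (pi x).\<close>

lemma term_lower_bound:
  fixes n :: int
  assumes "i + d * k = Suc j" and n: "period j / 8 < \<bar>of_int n\<bar>" "\<bar>of_int n\<bar> \<le> period (Suc j) / 8"
  shows "real (Suc j) \<le> weight (i + d * k) *
    (1 - cos (2 * pi * real (2 ^ freq_exp (i + d * k)) * (of_int n * alpha i)))"
proof -
  obtain z :: int and \<theta> where z: "real (2 ^ freq_exp (Suc j)) * alpha i = of_int z + \<theta>"
      and \<theta>: "1 / period (Suc j) \<le> \<theta>" "\<theta> \<le> 2 / period (Suc j)"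
    using alpha_phase[of i k] unfolding assms(1) by blast
  note P = period_pos[of j] period_pos[of "Suc j"]
  have \<theta>0: "\<theta> > 0" using \<theta>(1) P by (meson less_le_trans zero_less_divide_1_iff)
  define x where "x = \<bar>of_int n\<bar> * \<theta>"
  have "x \<le> period (Suc j) / 8 * (2 / period (Suc j))"
    unfolding x_def using n(2) \<theta>(2) \<theta>0 P by (intro mult_mono) simp_all
  then have x_le: "x \<le> 1 / 4" using P by simp
  have "period j / 8 * (1 / period (Suc j)) \<le> x"
    unfolding x_def using n(1) \<theta>(1) P by (intro mult_mono) simp_all
  then have x_ge: "period j / period (Suc j) / 8 \<le> x" by simp
  have "pi * x / 2 \<le> sin (pi * x)"
    using sin_ge_half[of "pi * x"] x_le \<theta>0 by (simp add: x_def)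
  moreover have "2 * x \<le> pi * x" using pi_gt3 \<theta>0 by (intro mult_right_mono) (simp_all add: x_def)
  ultimately have "x \<le> sin (pi * x)" by simp
  then have "(period j / period (Suc j) / 8)\<^sup>2 \<le> (sin (pi * x))\<^sup>2"
    using x_ge P by (intro power_mono) simp_all
  moreover have "cos (2 * pi * real (2 ^ freq_exp (Suc j)) * (of_int n * alpha i)) = 1 - 2 * (sin (pi * x))\<^sup>2"
  proof -
    have "2 * pi * real (2 ^ freq_exp (Suc j)) * (of_int n * alpha i) =
        2 * pi * of_int n * (real (2 ^ freq_exp (Suc j)) * alpha i)"
      by (simp only: mult_ac)
    also have "\<dots> = 2 * pi * of_int n * \<theta> + 2 * pi * of_int (n * z)"
      unfolding z by (simp add: algebra_simps)
    finally have "cos (2 * pi * real (2 ^ freq_exp (Suc j)) * (of_int n * alpha i)) = cos (2 * pi * of_int n * \<theta>)"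
      using cos_int_2pin[of "n * z"] sin_int_2pin[of "n * z"] by (simp only: cos_add)
    also have "\<dots> = cos (2 * (pi * x))"
      by (cases "n \<ge> 0") (simp_all add: x_def mult_ac)
    also have "\<dots> = 1 - 2 * (sin (pi * x))\<^sup>2"
      by (rule cos_double_sin)
    finally show ?thesis .
  qed
  ultimately have "2 * (period j / period (Suc j) / 8)\<^sup>2 \<le>
      1 - cos (2 * pi * real (2 ^ freq_exp (Suc j)) * (of_int n * alpha i))"
    by simp
  then have "weight (Suc j) * (2 * (period j / period (Suc j) / 8)\<^sup>2) \<le>
      weight (Suc j) * (1 - cos (2 * pi * real (2 ^ freq_exp (Suc j)) * (of_int n * alpha i)))"
    by (intro mult_left_mono weight_nonneg)
  moreover have "weight (Suc j) * (2 * (period j / period (Suc j) / 8)\<^sup>2) = real (Suc j)"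
    using P by (simp add: weight_def power_divide field_simps del: of_nat_Suc)
  ultimately show ?thesis unfolding assms(1) by simp
qed

lemma period_ge: "real j \<le> period j"
proof -
  have "freq_exp (Suc j) \<le> freq_exp (j + d)"
    using strict_mono_freq_exp d_pos by (simp add: strict_mono_less_eq)
  then have "freq_exp j + j \<le> freq_exp (j + d)"
    using fib_Suc_ge[of j] by (simp add: freq_exp_Suc)
  then have "(2::real) ^ (freq_exp j + j) \<le> 2 ^ freq_exp (j + d)"
    by (intro power_increasing) simp_all
  then have "2 ^ j \<le> period j" by (simp add: period_def power_add field_simps)
  moreover have "real j < 2 ^ j" by (rule of_nat_less_two_power)
  ultimately show ?thesis by linarith
qed

lemma coboundary_sum_alpha_nonneg:
  "0 \<le> coboundary_sum (\<lambda>k. weight (i + d * k)) (\<lambda>k. 2 ^ freq_exp (i + d * k)) (of_int n * alpha i) 0"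
proof -
  have "0 \<le> weight (i + d * 0) * (1 - cos (2 * pi * real (2 ^ freq_exp (i + d * 0)) * (of_int n * alpha i)))"
    by (intro mult_nonneg_nonneg weight_nonneg) simp
  also note single_term_le
  finally show ?thesis .
qed

text \<open>Every large time lies in one of the windows \<open>(period (j - 1) / 8, period j / 8]\<close>, and there the
  \<open>j\<close>-th transfer function has already grown by at least \<open>j\<close>.\<close>

lemma coboundary_sum_alpha_proper:
  "\<exists>N. \<forall>n. N \<le> \<bar>n\<bar> \<longrightarrow> B \<le> (\<Sum>i<d. coboundary_sum (\<lambda>k. weight (i + d * k))
      (\<lambda>k. 2 ^ freq_exp (i + d * k)) (of_int n * alpha i) 0)"
proof -
  obtain b :: nat where b: "B \<le> real b" using real_arch_simple by blast
  \<comment> \<open>The sum bounds every period up to \<open>b\<close>, so a time beyond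
    \<open>N\<close> lies past the first \<open>b\<close> windows.\<close>
  obtain N :: nat where N: "(\<Sum>j\<le>b. period j) < real N" using reals_Archimedean2 by blast
  have "B \<le> (\<Sum>i<d. coboundary_sum (\<lambda>k. weight (i + d * k))
      (\<lambda>k. 2 ^ freq_exp (i + d * k)) (of_int n * alpha i) 0)" if n: "int N \<le> \<bar>n\<bar>" for n
  proof -
    obtain j0 :: nat where "8 * \<bar>of_int n\<bar> \<le> real j0" using real_arch_simple by blast
    then have "\<bar>of_int n\<bar> \<le> period j0 / 8" using period_ge[of j0] by simp
    then have ex: "\<exists>j. \<bar>of_int n\<bar> \<le> period j / 8" by blast
    define j where "j = (LEAST j. \<bar>of_int n\<bar> \<le> period j / 8)"
    have j: "\<bar>of_int n\<bar> \<le> period j / 8" unfolding j_def by (rule LeastI_ex[OF ex])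
    have "b < j"
    proof (rule ccontr)
      assume "\<not> b < j"
      then have "period j \<le> (\<Sum>j\<le>b. period j)"
        using period_pos by (intro member_le_sum) (auto intro: less_imp_le)
      moreover have "real N \<le> \<bar>of_int n\<bar>" using n by linarith
      ultimately show False using j N period_pos[of j] by linarith
    qed
    then obtain l where l: "j = Suc l" by (cases j) auto
    have "\<not> \<bar>of_int n\<bar> \<le> period l / 8"
      using not_less_Least[of l "\<lambda>j. \<bar>of_int n\<bar> \<le> period j / 8"] l by (simp add: j_def)
    then have window: "period l / 8 < \<bar>of_int n\<bar>" "\<bar>of_int n\<bar> \<le> period (Suc l) / 8"
      using j l by simp_all
    \<comment> \<open>Frequency number \<open>j\<close> sits in coordinate \<open>j mod d\<close>,
      as term \<open>j div d\<close> of its series.\<close>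
    define i k where "i = j mod d" and "k = j div d"
    have ik: "i + d * k = Suc l" by (simp add: i_def k_def flip: l)
    have i: "i < d" using d_pos by (simp add: i_def)
    let ?F = "\<lambda>i. coboundary_sum (\<lambda>k. weight (i + d * k)) (\<lambda>k. 2 ^ freq_exp (i + d * k)) (of_int n * alpha i) 0"
    have "B \<le> real (Suc l)" using b \<open>b < j\<close> l by linarith
    also have "\<dots> \<le> ?F i"
      by (rule order_trans[OF term_lower_bound[OF ik window] single_term_le])
    also have "\<dots> \<le> (\<Sum>i<d. ?F i)"
      using i by (intro member_le_sum coboundary_sum_alpha_nonneg) simp_all
    finally show ?thesis .
  qed
  then show ?thesis by blast
qed

text \<open>Multiply the relation by \<open>2 ^ freq_exp j\<close>, where
  \<open>Suc j = J = i0 + d * K\<close>. Modulo 1 only digits after place \<open>freq_exp j\<close>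
  remain: the first is at \<open>freq_exp J\<close> for \<open>i0\<close>, and at
  \<open>freq_exp (Suc J)\<close> or later for the others. So \<open>\<tau> i0\<close> dominates,
  and for \<open>b i0\<close> \<noteq> 0 the tails would combine to a nonzero integer
  \<open>X\<close> with |X| < 1.\<close>

lemma alpha_independent:
  assumes "(\<Sum>i<d. of_int (b i) * alpha i) \<in> \<int>" and i0: "i0 < d"
  shows "b i0 = 0"
proof (rule ccontr)
  assume b0: "b i0 \<noteq> 0"
  define S where "S = (\<Sum>i<d. \<bar>real_of_int (b i)\<bar>)"
  \<comment> \<open>From index \<open>K0\<close> on, consecutive exponents differ by at least
    \<open>K0\<close>, so the ratio of the powers of 2 outweighs the coefficients.\<close>
  obtain K0 :: nat where K0: "2 * S < real K0" using reals_Archimedean2 by blast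
  define K where "K = Suc K0"
  define J where "J = i0 + d * K"
  have "K * 1 \<le> K * d" using d_pos by (intro mult_le_mono2) simp
  then have "K \<le> J" by (simp add: J_def mult.commute trans_le_add2)
  then obtain j where j: "J = Suc j" "K0 \<le> j" by (cases J) (auto simp: K_def)
  define A where "A = (2::real) ^ freq_exp j / 2 ^ freq_exp J"
  have A: "A > 0" by (simp add: A_def)
  have small: "2 * S < 2 ^ fib (Suc n)" if "K0 \<le> n" for n
  proof -
    have "real K0 < 2 ^ K0" by (rule of_nat_less_two_power)
    also have "(2::real) ^ K0 \<le> 2 ^ fib (Suc n)"
      using fib_Suc_ge[of n] that by (intro power_increasing) simp_all
    finally show ?thesis using K0 by linarith
  qed
  have AS: "2 * S * A < 1"
    using small[OF j(2)] by (simp add: A_def j(1) freq_exp_Suc power_add)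
  have gap: "2 * S * ((2::real) ^ freq_exp j / 2 ^ freq_exp (Suc J)) < A"
  proof -
    have "(2::real) ^ freq_exp j / 2 ^ freq_exp (Suc J) = A / 2 ^ fib (Suc J)"
      by (simp add: A_def freq_exp_Suc power_add)
    moreover have "2 * S / 2 ^ fib (Suc J) < 1" using small[of J] j by simp
    then have "2 * S / 2 ^ fib (Suc J) * A < 1 * A" using A by (rule mult_strict_right_mono)
    ultimately show ?thesis by simp
  qed
  have "\<exists>(z::int) \<tau>. 2 ^ freq_exp j * alpha i = of_int z + \<tau> \<and>
      (if i = i0 then A \<le> \<tau> \<and> \<tau> \<le> 2 * A
       else 0 \<le> \<tau> \<and> \<tau> \<le> 2 * ((2::real) ^ freq_exp j / 2 ^ freq_exp (Suc J)))" if i: "i < d" for i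
  proof -
    \<comment> \<open>\<open>i + d * k\<close> is the last index at most \<open>j\<close> in the
      residue class of \<open>i\<close>. The next one is \<open>J\<close> for \<open>i = i0\<close>
      and larger than \<open>J\<close> otherwise.\<close>
    define k where "k = (if i < i0 then K else K0)"
    have le: "i + d * k \<le> j"
      using i i0 j(1) by (auto simp: k_def J_def K_def)
    then have "freq_exp (i + d * k) \<le> freq_exp j"
      using strict_mono_freq_exp by (simp add: strict_mono_less_eq)
    from alpha_expansion[OF this] obtain z :: int and \<tau> where z: "2 ^ freq_exp j * alpha i = of_int z + \<tau>"
      and \<tau>: "2 ^ freq_exp j / 2 ^ freq_exp (i + d * Suc k) \<le> \<tau>"
        "\<tau> \<le> 2 * (2 ^ freq_exp j / 2 ^ freq_exp (i + d * Suc k))"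
      by blast
    show ?thesis
    proof (cases "i = i0")
      case True
      then have "i + d * Suc k = J" by (simp add: k_def J_def K_def)
      with z \<tau> True show ?thesis by (auto simp: A_def)
    next
      case False
      then have "Suc J \<le> i + d * Suc k"
        using i0 by (auto simp: k_def J_def K_def)
      then have "freq_exp (Suc J) \<le> freq_exp (i + d * Suc k)"
        using strict_mono_freq_exp by (simp add: strict_mono_less_eq)
      then have "(2::real) ^ freq_exp j / 2 ^ freq_exp (i + d * Suc k) \<le> 2 ^ freq_exp j / 2 ^ freq_exp (Suc J)"
        by (intro divide_left_mono power_increasing) simp_all
      moreover have "0 \<le> (2::real) ^ freq_exp j / 2 ^ freq_exp (i + d * Suc k)" by simp
      ultimately have "0 \<le> \<tau>" "\<tau> \<le> 2 * ((2::real) ^ freq_exp j / 2 ^ freq_exp (Suc J))"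
        using \<tau> by linarith+
      with z False show ?thesis by auto
    qed
  qed
  then obtain z :: "nat \<Rightarrow> int" and \<tau> where z: "\<And>i. i < d \<Longrightarrow> 2 ^ freq_exp j * alpha i = of_int (z i) + \<tau> i"
    and \<tau>0: "\<And>i. i < d \<Longrightarrow> i = i0 \<Longrightarrow> A \<le> \<tau> i \<and> \<tau> i \<le> 2 * A"
    and \<tau>: "\<And>i. i < d \<Longrightarrow> i \<noteq> i0 \<Longrightarrow> 0 \<le> \<tau> i \<and> \<tau> i \<le> 2 * ((2::real) ^ freq_exp j / 2 ^ freq_exp (Suc J))"
    by metis
  define X where "X = (\<Sum>i<d. of_int (b i) * \<tau> i)"
  have "2 ^ freq_exp j * (\<Sum>i<d. of_int (b i) * alpha i) = of_int (\<Sum>i<d. b i * z i) + X"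
  proof -
    have "2 ^ freq_exp j * (\<Sum>i<d. of_int (b i) * alpha i) = (\<Sum>i<d. of_int (b i) * (2 ^ freq_exp j * alpha i))"
      by (simp add: sum_distrib_left mult_ac)
    also have "\<dots> = (\<Sum>i<d. of_int (b i * z i) + of_int (b i) * \<tau> i)"
      by (intro sum.cong) (simp_all add: z distrib_left)
    finally show ?thesis by (simp add: X_def sum.distrib)
  qed
  then have "X = 2 ^ freq_exp j * (\<Sum>i<d. of_int (b i) * alpha i) - of_int (\<Sum>i<d. b i * z i)" by simp
  also have "\<dots> \<in> \<int>"
    using assms(1) by (intro Ints_diff Ints_mult Ints_power Ints_of_int Ints_numeral)
  finally have "X \<in> \<int>" .
  then obtain x :: int where x: "X = of_int x" by (auto elim: Ints_cases)
  let ?R = "\<Sum>i\<in>{..<d} - {i0}. of_int (b i) * \<tau> i"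
  have X: "X = of_int (b i0) * \<tau> i0 + ?R"
    unfolding X_def using i0 by (subst sum.remove[of _ i0]) simp_all
  have "\<bar>?R\<bar> \<le> (\<Sum>i\<in>{..<d} - {i0}. \<bar>real_of_int (b i)\<bar> * (2 * ((2::real) ^ freq_exp j / 2 ^ freq_exp (Suc J))))"
  proof (intro order_trans[OF sum_abs sum_mono])
    fix i assume "i \<in> {..<d} - {i0}"
    then have "\<bar>\<tau> i\<bar> \<le> 2 * ((2::real) ^ freq_exp j / 2 ^ freq_exp (Suc J))" using \<tau>[of i] by simp
    then show "\<bar>of_int (b i) * \<tau> i\<bar> \<le> \<bar>real_of_int (b i)\<bar> * (2 * ((2::real) ^ freq_exp j / 2 ^ freq_exp (Suc J)))"
      unfolding abs_mult by (rule mult_left_mono) simp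
  qed
  also have "\<dots> = (\<Sum>i\<in>{..<d} - {i0}. \<bar>real_of_int (b i)\<bar>) * (2 * ((2::real) ^ freq_exp j / 2 ^ freq_exp (Suc J)))"
    by (rule sum_distrib_right[symmetric])
  also have "\<dots> \<le> S * (2 * ((2::real) ^ freq_exp j / 2 ^ freq_exp (Suc J)))"
    unfolding S_def by (intro mult_right_mono sum_mono2) auto
  also have "\<dots> < A" using gap by (simp only: mult_ac)
  finally have R: "\<bar>?R\<bar> < A" .
  have "1 * A \<le> \<bar>of_int (b i0)\<bar> * \<tau> i0"
    using b0 \<tau>0[OF i0 refl] A by (intro mult_mono) (simp_all flip: of_int_abs)
  then have "A \<le> \<bar>of_int (b i0) * \<tau> i0\<bar>" using \<tau>0[OF i0 refl] A by (simp add: abs_mult)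
  with R X have "X \<noteq> 0" by linarith
  moreover have "\<bar>X\<bar> < 1"
  proof -
    have "(2::real) ^ freq_exp j / 2 ^ freq_exp (Suc J) \<le> A"
      unfolding A_def by (intro divide_left_mono power_increasing) (simp_all add: freq_exp_Suc)
    then have "\<bar>of_int (b i) * \<tau> i\<bar> \<le> \<bar>real_of_int (b i)\<bar> * (2 * A)" if "i < d" for i
      unfolding abs_mult using \<tau>0[OF that] \<tau>[OF that] A by (intro mult_left_mono) (cases "i = i0"; simp)+
    then have "\<bar>X\<bar> \<le> (\<Sum>i<d. \<bar>real_of_int (b i)\<bar> * (2 * A))"
      unfolding X_def by (intro order_trans[OF sum_abs sum_mono]) simp
    also have "\<dots> = S * (2 * A)" unfolding S_def by (rule sum_distrib_right[symmetric])
    finally show ?thesis using AS by linarith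
  qed
  ultimately show False using x by simp
qed

end

section \<open>The cylindrical transformation\<close>

text \<open>Supplies the additional coordinate. The forbidden \<open>x\<close> are determined by
  finitely many integers, hence form a countable set.\<close>

lemma ex_real_notin_int_span:
  fixes f :: "nat \<Rightarrow> real"
  shows "\<exists>x. \<forall>b :: nat \<Rightarrow> int. \<forall>c :: int. c \<noteq> 0 \<longrightarrow> (\<Sum>i<d. of_int (b i) * f i) + of_int c * x \<notin> \<int>"
proof -
  define g where "g = (\<lambda>(l :: int list, c :: int, z :: int). (of_int z - (\<Sum>i<d. of_int (l ! i) * f i)) / of_int c)"
  have "countable (range g)" by (intro countable_image) simp
  then have "range g \<noteq> UNIV" using uncountable_UNIV_real by metis
  then obtain x where x: "x \<notin> range g" by blast
  have "(\<Sum>i<d. of_int (b i) * f i) + of_int c * x \<notin> \<int>" if c: "c \<noteq> 0" for b :: "nat \<Rightarrow> int" and c :: int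
  proof
    assume "(\<Sum>i<d. of_int (b i) * f i) + of_int c * x \<in> \<int>"
    then obtain z :: int where z: "(\<Sum>i<d. of_int (b i) * f i) + of_int c * x = of_int z"
      by (auto elim: Ints_cases)
    have "(\<Sum>i<d. of_int (map b [0..<d] ! i) * f i) = (\<Sum>i<d. of_int (b i) * f i)"
      by (intro sum.cong) simp_all
    then have "g (map b [0..<d], c, z) = x"
      using z c by (simp add: g_def field_simps)
    with x show False by (metis rangeI)
  qed
  then show ?thesis by blast
qed

text \<open>Independence modulo 1 is linear independence over the integers after 1 is appended as
  the entry \<open>\<theta> D\<close>; this is the form to which Kronecker's theorem
  applies.\<close>

lemma kronecker_mod_1:
  fixes a y :: "nat \<Rightarrow> real"
  assumes indep: "\<And>b :: nat \<Rightarrow> int. (\<Sum>i<D. of_int (b i) * a i) \<in> \<int> \<Longrightarrow> \<forall>i<D. b i = 0"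
    and e: "e > 0"
  shows "\<exists>n::int. \<forall>i<D. nrm (of_int n * a i - y i) < e"
proof -
  interpret M: Modules.module "\<lambda>r x. real_of_int r * x"
    by unfold_locales (simp_all add: algebra_simps)
  define \<theta> where "\<theta> i = (if i < D then a i else 1)" for i
  have zero: "b i = 0" if eq: "(\<Sum>i\<le>D. of_int (b i) * \<theta> i) = 0" and i: "i \<le> D" for b :: "nat \<Rightarrow> int" and i
  proof -
    have sum: "(\<Sum>i<D. of_int (b i) * a i) + of_int (b D) = 0"
      using eq by (simp add: \<theta>_def lessThan_Suc_atMost[symmetric])
    then have "(\<Sum>i<D. of_int (b i) * a i) = of_int (- b D)" by simp
    then have "(\<Sum>i<D. of_int (b i) * a i) \<in> \<int>" by (simp only: Ints_of_int)
    from indep[OF this] have b: "\<forall>i<D. b i = 0" .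
    with sum have "b D = 0" by simp
    with b i show ?thesis by (cases "i = D") auto
  qed
  \<comment> \<open>Independence is a property of the image set, so the entries have to be distinct;
    a coincidence would be a relation with coefficients 1 and -1.\<close>
  have inj: "inj_on \<theta> {..D}"
  proof (rule inj_onI, rule ccontr)
    fix i j assume ij: "i \<in> {..D}" "j \<in> {..D}" "\<theta> i = \<theta> j" "i \<noteq> j"
    define b where "b k = (if k = i then 1 else 0) - (if k = j then 1 else 0 :: int)" for k
    have "(\<Sum>k\<le>D. of_int (b k) * \<theta> k) = (\<Sum>k\<le>D. (if k = i then \<theta> k else 0) - (if k = j then \<theta> k else 0))"
      by (intro sum.cong) (auto simp: b_def)
    also have "\<dots> = 0" using ij by (simp add: sum_subtractf)
    finally have "b i = 0" using ij(1) by (intro zero) auto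
    then show False using ij(4) by (simp add: b_def)
  qed
  have "M.independent (\<theta> ` {..D})"
    unfolding M.dependent_finite[OF finite_imageI[OF finite_atMost]]
  proof
    assume "\<exists>u. (\<exists>v\<in>\<theta> ` {..D}. u v \<noteq> 0) \<and> (\<Sum>v\<in>\<theta> ` {..D}. real_of_int (u v) * v) = 0"
    then obtain u i where u: "i \<le> D" "u (\<theta> i) \<noteq> 0" "(\<Sum>v\<in>\<theta> ` {..D}. real_of_int (u v) * v) = 0"
      by auto
    then have "(\<Sum>i\<le>D. of_int (u (\<theta> i)) * \<theta> i) = 0"
      using sum.reindex[OF inj, of "\<lambda>v. real_of_int (u v) * v"] by simp
    from zero[OF this u(1)] u(2) show False by simp
  qed
  moreover have "\<theta> D = 1" by (simp add: \<theta>_def)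
  ultimately obtain k m where km: "\<And>i. i < D \<Longrightarrow> \<bar>of_int k * \<theta> i - of_int (m i) - y i\<bar> < e"
    using Kronecker_thm_2[OF _ inj _ e, of y] by metis
  have "nrm (of_int k * a i - y i) < e" if "i < D" for i
    unfolding nrm_less_iff
    using km[OF that] that by (intro exI[of _ "m i"]) (simp add: \<theta>_def algebra_simps)
  then show ?thesis by blast
qed

section \<open>Coboundary sums as functions on the circle and the torus\<close>

lemma coboundary_sum_rep_circle:
  "coboundary_sum c q b (rep_circle (to_circle t)) = coboundary_sum c q b t"
  using rep_circle_to_circle[of t] coboundary_sum_shift_int by metis

lemma coboundary_sum_nrm_lipschitz:
  assumes "admissible (Suc 0) c q b"
  shows "\<exists>L\<ge>0. \<forall>s t \<delta>. nrm (t - s) < \<delta> \<longrightarrow> \<bar>coboundary_sum c q b t - coboundary_sum c q b s\<bar> \<le> L * \<delta>"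
proof -
  obtain L where L: "L \<ge> 0" "\<And>s t. \<bar>coboundary_sum c q b t - coboundary_sum c q b s\<bar> \<le> L * \<bar>t - s\<bar>"
    using coboundary_sum_lipschitz[OF assms] by blast
  have "\<bar>coboundary_sum c q b t - coboundary_sum c q b s\<bar> \<le> L * \<delta>" if "nrm (t - s) < \<delta>" for s t \<delta>
  proof -
    have "\<exists>m::int. \<bar>t - s - of_int m\<bar> < \<delta>" using that by (simp only: nrm_less_iff)
    then obtain m :: int where m: "\<bar>t - s - of_int m\<bar> < \<delta>" by blast
    have "\<bar>coboundary_sum c q b t - coboundary_sum c q b (s + of_int m)\<bar> \<le> L * \<bar>t - (s + of_int m)\<bar>"
      by (rule L(2))
    also have "\<dots> \<le> L * \<delta>" using m L(1) by (intro mult_left_mono) simp_all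
    finally show ?thesis by (simp only: coboundary_sum_shift_int)
  qed
  with L(1) show ?thesis by blast
qed

text \<open>\<open>rep_circle\<close> picks arbitrary representatives; continuity, and with it
  measurability, comes from the periodic Lipschitz bound.\<close>

lemma continuous_on_coboundary_sum_circle:
  assumes "admissible (Suc 0) c q b"
  shows "continuous_on UNIV (\<lambda>z. coboundary_sum c q b (rep_circle z))"
  unfolding continuous_on_iff
proof (intro ballI allI impI)
  fix z :: circle and e :: real assume e: "e > 0"
  obtain L where L: "L \<ge> 0"
    "\<And>s t \<delta>. nrm (t - s) < \<delta> \<Longrightarrow> \<bar>coboundary_sum c q b t - coboundary_sum c q b s\<bar> \<le> L * \<delta>"
    using coboundary_sum_nrm_lipschitz[OF assms] by blast
  show "\<exists>\<delta>>0. \<forall>z'\<in>UNIV. dist z' z < \<delta> \<longrightarrow>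
      dist (coboundary_sum c q b (rep_circle z')) (coboundary_sum c q b (rep_circle z)) < e"
  proof (intro exI[of _ "e / (L + 1)"] conjI ballI impI)
    show "e / (L + 1) > 0" using e L(1) by simp
    fix z' assume "dist z' z < e / (L + 1)"
    then have "nrm (rep_circle z' - rep_circle z) < e / (L + 1)"
      using dist_to_circle[of "rep_circle z'" "rep_circle z"] by simp
    from L(2)[OF this]
    have "\<bar>coboundary_sum c q b (rep_circle z') - coboundary_sum c q b (rep_circle z)\<bar> \<le> L * (e / (L + 1))" .
    also have "\<dots> < e" using e L(1) by (simp add: field_simps)
    finally show "dist (coboundary_sum c q b (rep_circle z')) (coboundary_sum c q b (rep_circle z)) < e"
      by (simp add: dist_real_def)
  qed
qed

lemma coboundary_sum_circle_measure:
  assumes adm: "admissible (Suc 0) c q b"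
  shows "integrable circle_measure (\<lambda>z. coboundary_sum c q b (rep_circle z))"
    and "(\<integral>z. coboundary_sum c q b (rep_circle z) \<partial>circle_measure) = 0"
proof -
  let ?h = "coboundary_sum c q b"
  have [measurable]: "to_circle \<in> measurable (restrict_space lborel {0..<1}) borel"
    using continuous_on_to_circle
    by (intro measurable_restrict_space1) (simp add: borel_measurable_continuous_onI)
  have [measurable]: "(\<lambda>z. ?h (rep_circle z)) \<in> borel_measurable borel"
    by (rule borel_measurable_continuous_onI[OF continuous_on_coboundary_sum_circle[OF adm]])
  have "continuous_on UNIV ?h"
    using Cr_real_imp_continuous[OF Cr_real_coboundary_sum[OF adm]] .
  then have "continuous_on {0..1} ?h" by (rule continuous_on_subset) simp
  then have "set_integrable lborel {0..1} ?h" by (rule borel_integrable_atLeastAtMost')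
  then have int01: "set_integrable lborel {0..<1} ?h"
    by (rule set_integrable_subset) auto
  have "integrable (restrict_space lborel {0..<1}) (\<lambda>t. ?h (rep_circle (to_circle t)))"
    unfolding coboundary_sum_rep_circle
    using int01 by (simp add: integrable_restrict_space set_integrable_def)
  then show "integrable circle_measure (\<lambda>z. ?h (rep_circle z))"
    unfolding circle_measure_def by (subst integrable_distr_eq) auto
  have "(\<integral>z. ?h (rep_circle z) \<partial>circle_measure) =
      (\<integral>t. ?h (rep_circle (to_circle t)) \<partial>restrict_space lborel {0..<1})"
    unfolding circle_measure_def by (rule integral_distr) measurable
  also have "\<dots> = (LINT t:{0..<1}|lborel. ?h t)"
    unfolding coboundary_sum_rep_circle by (simp add: integral_restrict_space set_lebesgue_integral_def)
  also have "\<dots> = integral {0..<1} ?h"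
    by (rule set_borel_integral_eq_integral(2)[OF int01])
  also have "\<dots> = integral {0..1} ?h"
    by (rule integral_subset_negligible) (auto intro: negligible_subset[of "{1}"])
  also have "\<dots> = 0" by (rule coboundary_sum_integral[OF adm])
  finally show "(\<integral>z. ?h (rep_circle z) \<partial>circle_measure) = 0" .
qed

lemma torus_integral_component:
  assumes "i < D" "integrable circle_measure f"
  shows "integrable (torus_measure D) (\<lambda>x. f (x i))"
    and "(\<integral>x. f (x i) \<partial>torus_measure D) = (\<integral>z. f z \<partial>circle_measure :: real)"
proof -
  have distr: "distr (torus_measure D) circle_measure (\<lambda>x. x i) = circle_measure"
    unfolding torus_measure_def using assms(1)
    by (intro distr_PiM_component prob_space_circle_measure) simp
  have m: "(\<lambda>x. x i) \<in> measurable (torus_measure D) circle_measure"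
    unfolding torus_measure_def using assms(1) by (intro measurable_component_singleton) simp
  have f: "f \<in> borel_measurable circle_measure" using assms(2) by simp
  show "integrable (torus_measure D) (\<lambda>x. f (x i))"
    using integrable_distr_eq[OF m f] assms(2) by (simp add: distr)
  show "(\<integral>x. f (x i) \<partial>torus_measure D) = (\<integral>z. f z \<partial>circle_measure)"
    using integral_distr[OF m f] by (simp add: distr)
qed

section \<open>The cylindrical transformation of a separated sum of coboundaries\<close>

locale coboundary_data =
  fixes r D :: nat and a :: "nat \<Rightarrow> real" and c :: "nat \<Rightarrow> nat \<Rightarrow> real" and q :: "nat \<Rightarrow> nat \<Rightarrow> nat"
  assumes r: "r \<ge> 1"
    and adm: "\<And>i. i < D \<Longrightarrow> admissible r (c i) (q i) (a i)"
    and indep: "\<And>b :: nat \<Rightarrow> int. (\<Sum>i<D. of_int (b i) * a i) \<in> \<int> \<Longrightarrow> \<forall>i<D. b i = 0"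
    and proper_0: "\<And>B. \<exists>N. \<forall>n. N \<le> \<bar>n\<bar> \<longrightarrow> B \<le> (\<Sum>i<D. coboundary_sum (c i) (q i) (of_int n * a i) 0)"
begin

text \<open>The \<open>n\<close>-th Birkhoff sum of \<phi> on lifts in telescoped form: one
  coboundary sum with rotation numbers \<open>n * a i\<close>, for \<open>n\<close> of either
  sign.\<close>

definition \<psi> :: "int \<Rightarrow> (nat \<Rightarrow> real) \<Rightarrow> real"
  where "\<psi> n y = (\<Sum>i<D. coboundary_sum (c i) (q i) (of_int n * a i) (y i))"

definition \<phi> :: "(nat \<Rightarrow> circle) \<Rightarrow> real"
  where "\<phi> x = (\<Sum>i<D. coboundary_sum (c i) (q i) (a i) (rep_circle (x i)))"

lemma adm_Suc_0: "i < D \<Longrightarrow> admissible (Suc 0) (c i) (q i) (of_int n * a i)"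
  using r by (intro admissible_int_mult admissible_mono[OF adm]) simp_all

lemma \<phi>_to_torus: "\<phi> (to_torus D y) = \<psi> 1 y"
  by (simp add: \<phi>_def \<psi>_def to_torus_nth coboundary_sum_rep_circle)

sublocale proper_cocycle D a \<psi>
proof
  show "\<exists>n::int. \<forall>i<D. nrm (of_int n * a i - y i) < e" if "e > 0" for y e
    using indep that by (rule kronecker_mod_1)
  show "\<psi> (n + m) y = \<psi> n y + \<psi> m (\<lambda>i. y i + of_int n * a i)" for n m y
    unfolding \<psi>_def sum.distrib[symmetric]
    by (intro sum.cong) (simp_all add: distrib_right coboundary_sum_add[OF adm_Suc_0 adm_Suc_0])
  show "\<exists>\<delta>>0. \<forall>y z. (\<forall>i<D. nrm (y i - z i) < \<delta>) \<longrightarrow> \<bar>\<psi> n y - \<psi> n z\<bar> < e" if e: "e > 0" for n e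
  proof -
    let ?h = "\<lambda>i. coboundary_sum (c i) (q i) (of_int n * a i)"
    have "\<forall>i. \<exists>L. i < D \<longrightarrow> L \<ge> 0 \<and> (\<forall>s t \<delta>. nrm (t - s) < \<delta> \<longrightarrow> \<bar>?h i t - ?h i s\<bar> \<le> L * \<delta>)"
      using coboundary_sum_nrm_lipschitz[OF adm_Suc_0] by metis
    then obtain L where L: "\<forall>i. i < D \<longrightarrow> L i \<ge> 0 \<and> (\<forall>s t \<delta>. nrm (t - s) < \<delta> \<longrightarrow> \<bar>?h i t - ?h i s\<bar> \<le> L i * \<delta>)"
      by (rule choice[THEN exE])
    define S where "S = (\<Sum>i<D. L i)"
    have S: "S \<ge> 0" unfolding S_def using L by (intro sum_nonneg) simp
    show ?thesis
    proof (intro exI[of _ "e / (S + 1)"] conjI allI impI)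
      show "e / (S + 1) > 0" using e S by simp
      fix y z assume yz: "\<forall>i<D. nrm (y i - z i) < e / (S + 1)"
      have "\<bar>\<psi> n y - \<psi> n z\<bar> \<le> (\<Sum>i<D. \<bar>?h i (y i) - ?h i (z i)\<bar>)"
        unfolding \<psi>_def sum_subtractf[symmetric] by (rule sum_abs)
      also have "\<dots> \<le> (\<Sum>i<D. L i * (e / (S + 1)))"
      proof (rule sum_mono)
        fix i assume "i \<in> {..<D}"
        then have i: "i < D" by simp
        show "\<bar>?h i (y i) - ?h i (z i)\<bar> \<le> L i * (e / (S + 1))"
          using L[rule_format, OF i] yz[rule_format, OF i] by blast
      qed
      also have "\<dots> = S * (e / (S + 1))" unfolding S_def by (rule sum_distrib_right[symmetric])
      also have "\<dots> < e" using e S by (simp add: field_simps)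
      finally show "\<bar>\<psi> n y - \<psi> n z\<bar> < e" .
    qed
  qed
  show "\<exists>z. \<psi> n z = 0" for n
  proof -
    \<comment> \<open>The summands depend on different coordinates, so their zeros combine to a zero
      of the sum.\<close>
    have "\<forall>i. \<exists>z. i < D \<longrightarrow> coboundary_sum (c i) (q i) (of_int n * a i) z = 0"
      using coboundary_sum_has_zero[OF adm_Suc_0] by blast
    then obtain z where "\<forall>i. i < D \<longrightarrow> coboundary_sum (c i) (q i) (of_int n * a i) (z i) = 0"
      by (rule choice[THEN exE])
    then show ?thesis by (intro exI[of _ z]) (simp add: \<psi>_def)
  qed
  show "\<exists>N. \<forall>n. N \<le> \<bar>n\<bar> \<longrightarrow> B \<le> \<psi> n (\<lambda>_. 0)" for B
    using proper_0[of B] by (simp add: \<psi>_def)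
qed

lemma \<psi>_step: "\<psi> (n + 1) y - \<psi> n y = \<phi> (to_torus D (\<lambda>i. y i + of_int n * a i))"
  by (simp add: cocycle \<phi>_to_torus)

lemma birkhoff_sum_\<phi>:
  "birkhoff_sum (torus D) (torus_rotation D (to_torus D a)) \<phi> n (to_torus D y) = \<psi> n y"
  by (rule birkhoff_sum_eqI[where g = "\<lambda>n. \<psi> n y"])
    (simp_all only: \<psi>_0 \<psi>_step int_iterate_torus_rotation)

lemma torus_C_class_\<phi>: "torus_C_class D r \<phi>"
proof -
  have "C_class D r (\<lambda>x. \<Sum>i<D. coboundary_sum (c i) (q i) (a i) (x i))"
    by (intro C_class_separated Cr_real_coboundary_sum adm)
  then show ?thesis
    by (simp add: torus_C_class_def \<phi>_to_torus \<psi>_def)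
qed

lemma integral_\<phi>: "(\<integral>x. \<phi> x \<partial>torus_measure D) = 0"
proof -
  have ad: "admissible (Suc 0) (c i) (q i) (a i)" if "i < D" for i
    using adm_Suc_0[OF that, of 1] by simp
  have "(\<integral>x. \<phi> x \<partial>torus_measure D) =
      (\<Sum>i<D. \<integral>x. coboundary_sum (c i) (q i) (a i) (rep_circle (x i)) \<partial>torus_measure D)"
    unfolding \<phi>_def
    by (intro Bochner_Integration.integral_sum torus_integral_component(1) coboundary_sum_circle_measure(1) ad) simp_all
  also have "\<dots> = (\<Sum>i<D. 0)"
  proof (intro sum.cong refl)
    fix i assume "i \<in> {..<D}"
    then have i: "i < D" by simp
    show "(\<integral>x. coboundary_sum (c i) (q i) (a i) (rep_circle (x i)) \<partial>torus_measure D) = 0"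
      unfolding torus_integral_component(2)[OF i coboundary_sum_circle_measure(1)[OF ad[OF i]]]
      by (rule coboundary_sum_circle_measure(2)[OF ad[OF i]])
  qed
  finally show ?thesis by simp
qed

lemma filterlim_\<psi>_0: "filterlim (\<lambda>n. \<psi> n (\<lambda>_. 0)) at_top (filtercomap abs at_top)"
  unfolding filterlim_at_top eventually_filtercomap_at_top_linorder using proper by blast

lemma besicovitch_\<phi>: "besicovitch (torus_topology D) (torus_rotation D (to_torus D a)) \<phi>"
  unfolding besicovitch_def
proof (intro conjI)
  obtain y where y: "\<And>w t e. e > 0 \<Longrightarrow>
      \<exists>n. (\<forall>i<D. nrm (y i + of_int n * a i - w i) < e) \<and> \<bar>\<psi> n y - t\<bar> < e"
    using ex_dense_orbit by blast
  have "dense_orbit (prod_topology (torus_topology D) euclideanreal)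
      (cylindrical (torus_rotation D (to_torus D a)) \<phi>) (to_torus D y, 0)"
    by (rule dense_orbit_cylindrical[where \<psi> = \<psi>, OF \<psi>_0 \<psi>_step y])
  then show "\<exists>p\<in>topspace (torus_topology D) \<times> UNIV. dense_orbit (prod_topology (torus_topology D) euclideanreal)
      (cylindrical (torus_rotation D (to_torus D a)) \<phi>) p"
    by (intro bexI[of _ "(to_torus D y, 0)"]) simp_all
  have "filterlim (\<lambda>n. \<bar>\<psi> n (\<lambda>_. 0)\<bar>) at_top (filtercomap abs at_top)"
    by (rule filterlim_at_top_mono[OF filterlim_\<psi>_0]) (simp add: abs_ge_self)
  then have "discrete_orbit (torus D) (torus_rotation D (to_torus D a)) \<phi> (to_torus D (\<lambda>_. 0), 0)"
    by (simp add: discrete_orbit_def birkhoff_sum_\<phi>)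
  then show "\<exists>p\<in>topspace (torus_topology D) \<times> UNIV.
      discrete_orbit (topspace (torus_topology D)) (torus_rotation D (to_torus D a)) \<phi> p"
    by (intro bexI[of _ "(to_torus D (\<lambda>_. 0), 0)"]) simp_all
qed

lemma hausdorff_dim_D_plus_plus:
  assumes j: "j < D" and c0: "\<And>k. c j k = 0"
  shows "hausdorff_dim (torus_metric D) (D_plus_plus D (to_torus D a) \<phi>) > 0"
proof -
  have "to_torus D (\<lambda>i. if i = j then t else 0) \<in> D_plus_plus D (to_torus D a) \<phi>" for t
  proof -
    have "\<psi> n (\<lambda>i. if i = j then t else 0) = \<psi> n (\<lambda>_. 0)" for n
      unfolding \<psi>_def by (intro sum.cong) (auto simp: coboundary_sum_def c0)
    then show ?thesis
      using filterlim_\<psi>_0 by (simp add: D_plus_plus_def birkhoff_sum_\<phi>)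
  qed
  from hausdorff_dim_circle_ge[OF j this] show ?thesis
    using zero_less_one by (rule less_le_trans[rotated])
qed

lemma minimal_rotation: "minimal_map (torus_topology D) (torus_rotation D (to_torus D a))"
  by (rule minimal_map_torus_rotation[OF kronecker])

end

theorem mainTheorem4:
  fixes r :: nat
  assumes "r \<ge> 1"
  shows "\<exists>d\<ge>3. \<exists>\<alpha>\<in>torus d.
    minimal_map (torus_topology d) (torus_rotation d \<alpha>) \<and>
    (\<exists>\<phi> :: (nat \<Rightarrow> circle) \<Rightarrow> real.
       torus_C_class d r \<phi> \<and>
       (\<integral>x. \<phi> x \<partial>torus_measure d) = 0 \<and>
       besicovitch (torus_topology d) (torus_rotation d \<alpha>) \<phi> \<and>
       hausdorff_dim (torus_metric d) (D_plus_plus d \<alpha> \<phi>) > 0)"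
proof -
  \<comment> \<open>The value for which \<open>freq_exp_gap\<close> absorbs \<open>r\<close>
    derivatives. The torus will have dimension \<open>Suc d\<close>.\<close>
  define d where "d = 2 * r + 7"
  interpret L: lacunary_frequencies r d
    by unfold_locales (rule d_def)
  obtain x where x: "\<And>(b :: nat \<Rightarrow> int) c :: int. c \<noteq> 0 \<Longrightarrow>
      (\<Sum>i<d. of_int (b i) * L.alpha i) + of_int c * x \<notin> \<int>"
    using ex_real_notin_int_span[where d = d and f = L.alpha] by blast
  \<comment> \<open>Coordinate \<open>d\<close> rotates by \<open>x\<close> and has zero weights:
    the rotation stays minimal and \<phi> is constant along this circle.\<close>
  define a where "a i = (if i < d then L.alpha i else x)" for i
  define c where "c i k = (if i < d then L.weight (i + d * k) else 0)" for i k
  define q :: "nat \<Rightarrow> nat \<Rightarrow> nat" where "q i k = 2 ^ freq_exp (i + d * k)" for i k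
  interpret coboundary_data r "Suc d" a c q
  proof
    show "1 \<le> r" by (rule assms)
    show "admissible r (c i) (q i) (a i)" for i
    proof (cases "i < d")
      case True
      then show ?thesis
        using L.admissible_alpha[of i] by (simp add: a_def c_def[abs_def] q_def[abs_def])
    next
      case False
      then show ?thesis by (simp add: admissible_def a_def c_def q_def)
    qed
    show "\<forall>i<Suc d. b i = 0" if b: "(\<Sum>i<Suc d. of_int (b i) * a i) \<in> \<int>" for b :: "nat \<Rightarrow> int"
    proof -
      have eq: "(\<Sum>i<Suc d. of_int (b i) * a i) = (\<Sum>i<d. of_int (b i) * L.alpha i) + of_int (b d) * x"
        by (simp add: a_def)
      with b x have bd: "b d = 0" by metis
      with b have "(\<Sum>i<d. of_int (b i) * L.alpha i) \<in> \<int>" unfolding eq by simp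
      from L.alpha_independent[OF this] bd show ?thesis by (auto simp: less_Suc_eq)
    qed
    show "\<exists>N. \<forall>n. N \<le> \<bar>n\<bar> \<longrightarrow> B \<le> (\<Sum>i<Suc d. coboundary_sum (c i) (q i) (of_int n * a i) 0)" for B
    proof -
      have "(\<Sum>i<Suc d. coboundary_sum (c i) (q i) (of_int n * a i) 0) =
          (\<Sum>i<d. coboundary_sum (\<lambda>k. L.weight (i + d * k)) (\<lambda>k. 2 ^ freq_exp (i + d * k)) (of_int n * L.alpha i) 0)"
        for n
      proof -
        have "coboundary_sum (c d) (q d) (of_int n * a d) 0 = 0"
          by (simp add: coboundary_sum_def c_def)
        moreover have "(\<Sum>i<d. coboundary_sum (c i) (q i) (of_int n * a i) 0) =
          (\<Sum>i<d. coboundary_sum (\<lambda>k. L.weight (i + d * k)) (\<lambda>k. 2 ^ freq_exp (i + d * k)) (of_int n * L.alpha i) 0)"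
          by (intro sum.cong) (simp_all add: a_def c_def[abs_def] q_def[abs_def])
        ultimately show ?thesis by simp
      qed
      then show ?thesis using L.coboundary_sum_alpha_proper[of B] by presburger
    qed
  qed
  show ?thesis
  proof (intro exI[of _ "Suc d"] conjI bexI[of _ "to_torus (Suc d) a"] exI[of _ \<phi>])
    show "hausdorff_dim (torus_metric (Suc d)) (D_plus_plus (Suc d) (to_torus (Suc d) a) \<phi>) > 0"
      by (rule hausdorff_dim_D_plus_plus[of d]) (simp_all add: c_def)
    show "3 \<le> Suc d" by (simp add: d_def)
  qed (rule to_torus_in_torus minimal_rotation torus_C_class_\<phi> integral_\<phi> besicovitch_\<phi>)+
qed

end
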